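(* Let $(W,S)$ be a Coxeter system, $\mathbb{F}$ a field, and $\mathbf{q}=(q_s\in\mathbb{F}: s\in S)$ arbitrary parameters. The Hecke algebra $\mathcal{H}(\mathbf{q})$ of $(W,S)$ with independent parameters $\mathbf{q}$ is always spanned over $\mathbb{F}$ by the family $\{T_w: w\in W\}$. This family (indexed by $W$) is a basis of $\mathcal{H}(\mathbf{q})$ if and only if $q_s=q_t$ for all $s,t\in S$ with $m_{st}$ odd.
   Context: A Coxeter system $(W,S)$ has $S$ finite and $W=\langle S: s^2=1,\ (sts\cdots)_{m_{st}}=(tst\cdots)_{m_{st}}\ \forall s\ne t\in S\rangle$, where $m_{st}=m_{ts}\in\{2,3,\ldots\}\cup\{\infty\}$ and $(aba\cdots)_m$ denotes the alternating product of $m$ factors starting with $a$; no relation is imposed between $s$ and $t$ if $m_{st}=\infty$ (and $\infty$ is not odd). The Hecke algebra $\mathcal{H}(\mathbf{q})=\mathcal{H}_S(\mathbf{q})$ of $(W,S)$ with independent parameters $\mathbf{q}=(q_s\in\mathbb{F}:s\in S)$ is the unital associative $\mathbb{F}$-algebra generated by $\{T_s:s\in S\}$ subject to the quadratic relations $(T_s-1)(T_s+q_s)=0$ for all $s\in S$ and the braid relations $(T_sT_tT_s\cdots)_{m_{st}}=(T_tT_sT_t\cdots)_{m_{st}}$ for all $s\neq t$ in $S$ (none if $m_{st}=\infty$). For $w\in W$ with a reduced expression $w=st\cdots r$ ($s,t,\ldots,r\in S$), set $T_w:=T_sT_t\cdots T_r$; this is independent of the reduced expression chosen. *)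

theory Defs
  imports
    "HOL-Algebra.Generated_Groups"
    "HOL-Algebra.QuotRing"
    "HOL-Algebra.Module"
    "HOL-Library.Poly_Mapping"
    "HOL-Library.Extended_Nat"
begin

section \<open>Groups given by generators and relations\<close>

text \<open>Words in \<open>X \<union> X\<^sup>-\<^sup>1\<close> are lists of pairs: \<open>(x, True)\<close> stands for \<open>x\<close> and
  \<open>(x, False)\<close> for the formal inverse of \<open>x\<close>.\<close>

type_synonym 'a signed_word = "('a \<times> bool) list"

definition signed_eval :: "'a monoid \<Rightarrow> 'a signed_word \<Rightarrow> 'a" where
  "signed_eval G u =
     foldr (\<lambda>(x, b) y. (if b then x else inv\<^bsub>G\<^esub> x) \<otimes>\<^bsub>G\<^esub> y) u \<one>\<^bsub>G\<^esub>"

inductive pres_step :: "'a set \<Rightarrow> ('a signed_word \<times> 'a signed_word) set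
    \<Rightarrow> 'a signed_word \<Rightarrow> 'a signed_word \<Rightarrow> bool" for X R where
  cancel: "\<lbrakk>p \<in> lists (X \<times> UNIV); r \<in> lists (X \<times> UNIV); x \<in> X\<rbrakk>
    \<Longrightarrow> pres_step X R (p @ [(x, b), (x, \<not> b)] @ r) (p @ r)"
| rel: "\<lbrakk>p \<in> lists (X \<times> UNIV); r \<in> lists (X \<times> UNIV); (u, v) \<in> R\<rbrakk>
    \<Longrightarrow> pres_step X R (p @ u @ r) (p @ v @ r)"

text \<open>\<open>G = \<langle>X : u = v for all (u, v) \<in> R\<rangle>\<close> for a subset \<open>X\<close> of \<open>G\<close>: the canonical map from
  the group of words modulo \<open>R\<close> to \<open>G\<close> is surjective and injective.\<close>

definition has_presentation ::
    "'a monoid \<Rightarrow> 'a set \<Rightarrow> ('a signed_word \<times> 'a signed_word) set \<Rightarrow> bool" where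
  "has_presentation G X R \<longleftrightarrow>
     X \<subseteq> carrier G \<and> generate G X = carrier G \<and>
     (\<forall>u \<in> lists (X \<times> UNIV). \<forall>v \<in> lists (X \<times> UNIV).
        signed_eval G u = signed_eval G v \<longleftrightarrow> equivclp (pres_step X R) u v)"


section \<open>Coxeter systems\<close>

text \<open>\<open>alt_word k a b\<close> is the word \<open>aba\<dots>\<close> with \<open>k\<close> letters.\<close>

fun alt_word :: "nat \<Rightarrow> 'a \<Rightarrow> 'a \<Rightarrow> 'a list" where
  "alt_word 0 a b = []"
| "alt_word (Suc k) a b = a # alt_word k b a"

abbreviation pos_word :: "'a list \<Rightarrow> 'a signed_word" where
  "pos_word \<equiv> map (\<lambda>x. (x, True))"

definition coxeter_relations ::
    "'w set \<Rightarrow> ('w \<Rightarrow> 'w \<Rightarrow> enat) \<Rightarrow> ('w signed_word \<times> 'w signed_word) set" where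
  "coxeter_relations S m =
     {(pos_word [s, s], []) | s. s \<in> S} \<union>
     {(pos_word (alt_word k s t), pos_word (alt_word k t s)) | s t k.
        s \<in> S \<and> t \<in> S \<and> s \<noteq> t \<and> m s t = enat k}"

text \<open>Only the values \<open>m s t\<close> with \<open>s \<noteq> t\<close> in \<open>S\<close> are relevant.\<close>

definition coxeter_system :: "'w monoid \<Rightarrow> 'w set \<Rightarrow> ('w \<Rightarrow> 'w \<Rightarrow> enat) \<Rightarrow> bool" where
  "coxeter_system W S m \<longleftrightarrow>
     group W \<and> finite S \<and>
     (\<forall>s \<in> S. \<forall>t \<in> S. s \<noteq> t \<longrightarrow> m s t = m t s \<and> 2 \<le> m s t) \<and>
     has_presentation W S (coxeter_relations S m)"

definition word_prod :: "('a, 'b) monoid_scheme \<Rightarrow> 'a list \<Rightarrow> 'a" where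
  "word_prod G xs = foldr (\<lambda>x y. x \<otimes>\<^bsub>G\<^esub> y) xs \<one>\<^bsub>G\<^esub>"

definition reduced_expression :: "'w monoid \<Rightarrow> 'w set \<Rightarrow> 'w \<Rightarrow> 'w list \<Rightarrow> bool" where
  "reduced_expression W S w xs \<longleftrightarrow>
     xs \<in> lists S \<and> word_prod W xs = w \<and>
     (\<forall>ys \<in> lists S. word_prod W ys = w \<longrightarrow> length xs \<le> length ys)"


section \<open>Free associative algebras\<close>

text \<open>The free monoid, written additively because the product on \<open>'a \<Rightarrow>\<^sub>0 'f\<close> is convolution with
  respect to \<open>+\<close> on \<open>'a\<close>.\<close>

datatype 'a free_monoid = Word (letters: "'a list")

instantiation free_monoid :: (type) monoid_add
begin

definition "0 = Word []"

definition "u + v = Word (letters u @ letters v)"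

instance
  by standard (auto simp: zero_free_monoid_def plus_free_monoid_def)

end

type_synonym ('a, 'f) nc_poly = "'a free_monoid \<Rightarrow>\<^sub>0 'f"

definition nc_var :: "'a \<Rightarrow> ('a, 'f::field) nc_poly" where
  "nc_var x = Poly_Mapping.single (Word [x]) 1"

definition nc_const :: "'f::field \<Rightarrow> ('a, 'f) nc_poly" where
  "nc_const c = Poly_Mapping.single 0 c"

definition free_algebra :: "'a set \<Rightarrow> ('a, 'f::field) nc_poly ring" where
  "free_algebra X = \<lparr>
     carrier = {p. \<forall>u \<in> Poly_Mapping.keys p. letters u \<in> lists X},
     monoid.mult = (*), one = 1, ring.zero = 0, add = (+)\<rparr>"


section \<open>Hecke algebras with independent parameters\<close>

definition hecke_relators ::
    "'w set \<Rightarrow> ('w \<Rightarrow> 'w \<Rightarrow> enat) \<Rightarrow> ('w \<Rightarrow> 'f::field) \<Rightarrow> ('w, 'f) nc_poly set" where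
  "hecke_relators S m q =
     {(nc_var s - 1) * (nc_var s + nc_const (q s)) | s. s \<in> S} \<union>
     {prod_list (map nc_var (alt_word k s t)) - prod_list (map nc_var (alt_word k t s)) | s t k.
        s \<in> S \<and> t \<in> S \<and> s \<noteq> t \<and> m s t = enat k}"

text \<open>\<^const>\<open>genideal\<close> gives two-sided ideals.\<close>

definition hecke_ideal ::
    "'w set \<Rightarrow> ('w \<Rightarrow> 'w \<Rightarrow> enat) \<Rightarrow> ('w \<Rightarrow> 'f::field) \<Rightarrow> ('w, 'f) nc_poly set" where
  "hecke_ideal S m q = genideal (free_algebra S) (hecke_relators S m q)"

text \<open>The scalar \<open>c\<close> acts on the quotient as multiplication by the class of the constant \<open>c\<close>.\<close>

definition hecke_algebra ::
    "'w set \<Rightarrow> ('w \<Rightarrow> 'w \<Rightarrow> enat) \<Rightarrow> ('w \<Rightarrow> 'f::field) \<Rightarrow> ('f, ('w, 'f) nc_poly set) module" where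
  "hecke_algebra S m q =
     (let A = free_algebra S; I = hecke_ideal S m q; Q = A Quot I
      in \<lparr>carrier = carrier Q, monoid.mult = monoid.mult Q, one = one Q,
          ring.zero = ring.zero Q, add = add Q,
          smult = (\<lambda>c h. (I +>\<^bsub>A\<^esub> nc_const c) \<otimes>\<^bsub>Q\<^esub> h)\<rparr>)"

definition hecke_gen ::
    "'w set \<Rightarrow> ('w \<Rightarrow> 'w \<Rightarrow> enat) \<Rightarrow> ('w \<Rightarrow> 'f::field) \<Rightarrow> 'w \<Rightarrow> ('w, 'f) nc_poly set" where
  "hecke_gen S m q s = hecke_ideal S m q +>\<^bsub>free_algebra S\<^esub> nc_var s"

text \<open>\<open>T\<^sub>w\<close>. By Matsumoto's theorem the value does not depend on the reduced expression chosen.\<close>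

definition hecke_T :: "'w monoid \<Rightarrow> 'w set \<Rightarrow> ('w \<Rightarrow> 'w \<Rightarrow> enat) \<Rightarrow> ('w \<Rightarrow> 'f::field)
    \<Rightarrow> 'w \<Rightarrow> ('w, 'f) nc_poly set" where
  "hecke_T W S m q w =
     word_prod (hecke_algebra S m q)
       (map (hecke_gen S m q) (SOME xs. reduced_expression W S w xs))"


section \<open>Spanning families and bases\<close>

text \<open>\<open>M\<close> is a vector space over the field \<open>'f\<close> (with carrier all of \<open>'f\<close>). These are notions
  for families, not for their sets of values, so a basis family is injective.\<close>

definition spanning_family :: "('f::field, 'v) module \<Rightarrow> 'i set \<Rightarrow> ('i \<Rightarrow> 'v) \<Rightarrow> bool" where
  "spanning_family M I b \<longleftrightarrow>
     b \<in> I \<rightarrow> carrier M \<and>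
     (\<forall>x \<in> carrier M. \<exists>J c. finite J \<and> J \<subseteq> I \<and> x = (\<Oplus>\<^bsub>M\<^esub>i\<in>J. c i \<odot>\<^bsub>M\<^esub> b i))"

definition independent_family :: "('f::field, 'v) module \<Rightarrow> 'i set \<Rightarrow> ('i \<Rightarrow> 'v) \<Rightarrow> bool" where
  "independent_family M I b \<longleftrightarrow>
     b \<in> I \<rightarrow> carrier M \<and>
     (\<forall>J c. finite J \<and> J \<subseteq> I \<and> (\<Oplus>\<^bsub>M\<^esub>i\<in>J. c i \<odot>\<^bsub>M\<^esub> b i) = \<zero>\<^bsub>M\<^esub> \<longrightarrow> (\<forall>i\<in>J. c i = 0))"

definition basis_family :: "('f::field, 'v) module \<Rightarrow> 'i set \<Rightarrow> ('i \<Rightarrow> 'v) \<Rightarrow> bool" where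
  "basis_family M I b \<longleftrightarrow> independent_family M I b \<and> spanning_family M I b"

end

(*
  The reflections of a word u = s_1...s_n are the conjugates
  (s_1...s_{i-1}) s_i (s_1...s_{i-1})^-1.  The parity of each multiplicity depends only on the group
  element, so u is reduced iff they are distinct; this gives the exchange property.
  The numbers game (dual of the geometric representation) shows that s t has order exactly m s t,
  which makes alternating words up to that length reduced and yields Matsumoto's theorem.

  Spanning: the span of the T_w is stable under left multiplication by each T_s.

  If q is constant along odd edges, right multiplication by T_s is modelled by operators on functions on
  W.  They commute with the analogous left operators: the only critical case is t x = x s, where q s = q t
  because the parity of the number of letters r with q r = q s is an invariant of W.  Hence the braid
  relations need to be checked at the identity only, and evaluation there separates the T_w.

  Conversely, for m s t odd let a be the longest element of the group generated by s and t, and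
  b = s a = a t.  Then T_s T_a = T_a T_t, and expanding both sides by the quadratic relations gives
  (q t - q s) T_a + (q s - q t) T_b = 0.
*)
theory Submission
  imports Defs Complex_Main "HOL-Library.Multiset"
begin

section \<open>Alternating words\<close>

lemma alt_word_add:
  "alt_word (j + k) s t = alt_word j s t @ (if even j then alt_word k s t else alt_word k t s)"
  by (induction j arbitrary: s t) auto

lemma alt_word_Suc_right:
  "alt_word (Suc k) s t = alt_word k s t @ [if even k then s else t]"
  using alt_word_add[of k 1 s t] by simp

lemma length_alt_word [simp]: "length (alt_word k s t) = k"
  by (induction k arbitrary: s t) auto

lemma rev_alt_word:
  "rev (alt_word k s t) = (if odd k then alt_word k s t else alt_word k t s)"
proof (induction k arbitrary: s t)
  case (Suc k)
  have "rev (alt_word (Suc k) s t) = (if even k then s else t) # rev (alt_word k s t)"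
    by (simp only: alt_word_Suc_right rev_append) simp
  then show ?case
    by (simp add: Suc)
qed simp

text \<open>Generators are involutions, so reversing a word inverts its product. This splitting thus
  translates between \<open>(st)^k = 1\<close> and the braid relation with \<open>k\<close>
  letters.\<close>

lemma alt_word_double: "alt_word (2 * k) s t = alt_word k s t @ rev (alt_word k t s)"
  using alt_word_add[of k k s t] by (simp add: rev_alt_word mult_2)

lemma alt_word_in_lists: "s \<in> A \<Longrightarrow> t \<in> A \<Longrightarrow> alt_word k s t \<in> lists A"
  by (induction k arbitrary: s t) auto

lemma map_alt_word: "map f (alt_word k s t) = alt_word k (f s) (f t)"
  by (induction k arbitrary: s t) auto


section \<open>The numbers game\<close>

text \<open>The dual geometric representation in coordinates: if \<open>f r\<close> is the value of
  a linear functional at the simple root of \<open>r\<close>, this composes the functional with the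
  reflection in the root of \<open>s\<close>, where \<open>c s r\<close> stands for -2 times the
  bilinear form.\<close>

definition fire :: "('a \<Rightarrow> 'a \<Rightarrow> real) \<Rightarrow> 'a \<Rightarrow> ('a \<Rightarrow> real) \<Rightarrow> 'a \<Rightarrow> real" where
  "fire c s f = (\<lambda>r. if r = s then - f s else f r + c s r * f s)"

lemma fire_fire [simp]: "fire c s (fire c s f) = f"
  by (auto simp: fire_def fun_eq_iff)

lemma fold_fire_rev [simp]: "fold (fire c) (rev u) (fold (fire c) u f) = f"
  by (induction u arbitrary: f) auto

text \<open>\<open>U\<close> is the Chebyshev recursion: \<open>U n = sin (n \<theta>) / sin \<theta>\<close> if \<open>c s t = 2 cos \<theta>\<close>, and \<open>U n = n\<close> if \<open>c s t = 2\<close>.\<close>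

lemma fold_fire_alt_word:
  fixes U :: "nat \<Rightarrow> real"
  assumes "s \<noteq> t" "c t s = c s t"
    and U: "U 0 = 0" "U (Suc 0) = 1" "\<And>n. U (Suc (Suc n)) = c s t * U (Suc n) - U n"
  shows "fold (fire c) (alt_word (2 * d) s t) f s = f s * U (2 * d + 1) + f t * U (2 * d) \<and>
    fold (fire c) (alt_word (2 * d) s t) f t
      = f t * U (2 * d + 1) - (f s + c s t * f t) * U (2 * d)"
proof (induction d arbitrary: f)
  case 0
  show ?case by (simp add: U)
next
  case (Suc d)
  have eq: "fold (fire c) (alt_word (2 * Suc d) s t) f
      = fold (fire c) (alt_word (2 * d) s t) (fire c t (fire c s f))"
    by simp
  have ft: "fire c t (fire c s f) t = - (f t + c s t * f s)"
    and fs: "fire c t (fire c s f) s = - f s + c s t * (f t + c s t * f s)"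
    using assms(1,2) by (simp_all add: fire_def)
  have U2: "U (2 * Suc d) = c s t * U (2 * d + 1) - U (2 * d)"
    "U (2 * Suc d + 1) = c s t * (c s t * U (2 * d + 1) - U (2 * d)) - U (2 * d + 1)"
    using U(3)[of "2 * d"] U(3)[of "2 * d + 1"] by simp_all
  show ?case
    unfolding eq Suc[THEN conjunct1] Suc[THEN conjunct2] ft fs U2 by (simp add: algebra_simps)
qed

text \<open>The form is evaluation at the component of the root of \<open>r\<close> orthogonal to
  the roots of \<open>s\<close> and \<open>t\<close>, which both reflections fix; the two equations
  on \<alpha> and \<beta> express orthogonality. It controls the coordinates other than
  \<open>s\<close> and \<open>t\<close>.\<close>

lemma fire_linear_invariant:
  assumes "r \<noteq> s" "r \<noteq> t" "s \<noteq> t" "c t s = c s t"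
    and "c s r - 2 * \<alpha> + \<beta> * c s t = 0" "c t r - 2 * \<beta> + \<alpha> * c s t = 0"
    and "u \<in> lists {s, t}"
  shows "fold (fire c) u f r + \<alpha> * fold (fire c) u f s + \<beta> * fold (fire c) u f t
    = f r + \<alpha> * f s + \<beta> * f t"
  using assms(7)
proof (induction u arbitrary: f)
  case (Cons a u)
  have "fire c a f r + \<alpha> * fire c a f s + \<beta> * fire c a f t = f r + \<alpha> * f s + \<beta> * f t"
  proof -
    have "f r + c s r * f s - \<alpha> * f s + \<beta> * (f t + c s t * f s)
        = f r + \<alpha> * f s + \<beta> * f t + (c s r - 2 * \<alpha> + \<beta> * c s t) * f s"
      by (simp add: algebra_simps)
    moreover have "f r + c t r * f t + \<alpha> * (f s + c s t * f t) - \<beta> * f t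
        = f r + \<alpha> * f s + \<beta> * f t + (c t r - 2 * \<beta> + \<alpha> * c s t) * f t"
      by (simp add: algebra_simps)
    ultimately show ?thesis
      using Cons.hyps assms by (auto simp: fire_def)
  qed
  with Cons show ?case by simp
qed simp

lemma sin_recursion:
  fixes \<theta> :: real
  shows "sin (real (Suc (Suc n)) * \<theta>) = 2 * cos \<theta> * sin (real (Suc n) * \<theta>) - sin (real n * \<theta>)"
proof -
  have "sin (real (Suc (Suc n)) * \<theta>) = sin (real (Suc n) * \<theta> + \<theta>)"
    "sin (real n * \<theta>) = sin (real (Suc n) * \<theta> - \<theta>)"
    by (simp_all add: algebra_simps)
  then show ?thesis
    unfolding sin_add sin_diff by simp
qed

lemma fold_fire_alt_word_eq_id:
  assumes "s \<noteq> t" "c t s = c s t" "k \<ge> 2" "c s t = 2 * cos (pi / real k)"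
  shows "fold (fire c) (alt_word (2 * k) s t) f = f"
proof
  fix r
  define \<theta> where "\<theta> = pi / real k"
  have "sin \<theta> > 0"
    using \<open>k \<ge> 2\<close> unfolding \<theta>_def by (intro sin_gt_zero) (auto simp: field_simps)
  define U where "U = (\<lambda>n. sin (real n * \<theta>) / sin \<theta>)"
  have U: "U 0 = 0" "U (Suc 0) = 1" "U (Suc (Suc n)) = c s t * U (Suc n) - U n" for n
    using \<open>sin \<theta> > 0\<close> sin_recursion[of n \<theta>] assms(4)
    by (simp_all add: U_def \<theta>_def[symmetric] diff_divide_distrib)
  \<comment> \<open>\<open>2 * k\<close> moves make a full turn, so \<open>U\<close> at
    \<open>2 * k\<close> and \<open>2 * k + 1\<close> repeats its values at 0 and 1.\<close>
  have "real (2 * k) * \<theta> = 2 * pi" "real (2 * k + 1) * \<theta> = \<theta> + 2 * pi"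
    using \<open>k \<ge> 2\<close> by (simp_all add: \<theta>_def field_simps)
  then have U': "U (2 * k) = 0" "U (2 * k + 1) = 1"
    using \<open>sin \<theta> > 0\<close> by (simp_all only: U_def sin_periodic sin_two_pi) simp_all
  let ?g = "fold (fire c) (alt_word (2 * k) s t) f"
  have gs: "?g s = f s" and gt: "?g t = f t"
    using fold_fire_alt_word[where U = U and d = k and f = f, OF assms(1,2) U] U' by simp_all
  have "?g r = f r" if "r \<noteq> s" "r \<noteq> t"
  proof -
    \<comment> \<open>Determinant of the system for \<alpha> and \<beta> in
      \<open>fire_linear_invariant\<close>; the definitions below are Cramer's rule.\<close>
    let ?D = "4 - (c s t)\<^sup>2"
    have "?D = 4 * (sin \<theta>)\<^sup>2"
      by (simp add: assms(4) \<theta>_def[symmetric] cos_squared_eq power_mult_distrib)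
    then have D: "?D \<noteq> 0" using \<open>sin \<theta> > 0\<close> by simp
    define \<alpha> \<beta> where "\<alpha> = (2 * c s r + c s t * c t r) / ?D"
      and "\<beta> = (2 * c t r + c s t * c s r) / ?D"
    have "c s r - 2 * \<alpha> + \<beta> * c s t = 0" "c t r - 2 * \<beta> + \<alpha> * c s t = 0"
      using D unfolding \<alpha>_def \<beta>_def by (simp_all add: field_simps power2_eq_square)
    from fire_linear_invariant[OF that assms(1,2) this, where u = "alt_word (2 * k) s t" and f = f]
    show ?thesis using gs gt by (simp add: alt_word_in_lists)
  qed
  with gs gt show "?g r = f r" by auto
qed

lemma fold_fire_braid:
  assumes "s \<noteq> t" "c t s = c s t" "k \<ge> 2" "c s t = 2 * cos (pi / real k)"
  shows "fold (fire c) (alt_word k s t) f = fold (fire c) (alt_word k t s) f"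
proof -
  let ?u = "alt_word k s t" and ?v = "alt_word k t s"
  have "fold (fire c) (rev ?v) (fold (fire c) ?u f) = f"
    using fold_fire_alt_word_eq_id[OF assms, of f] by (simp add: alt_word_double)
  \<comment> \<open>Playing \<open>?v\<close> on both sides undoes the play of
    \<open>rev ?v\<close>.\<close>
  then have "fold (fire c) (rev (rev ?v)) (fold (fire c) (rev ?v) (fold (fire c) ?u f))
      = fold (fire c) ?v f"
    by simp
  then show ?thesis unfolding fold_fire_rev .
qed

text \<open>On the coordinates \<open>s\<close> and \<open>t\<close>, \<open>(st)^d\<close> acts as
  a rotation by \<open>2 * d * pi / k\<close> with \<open>0 < d < k\<close>, or with linear growth
  in \<open>d\<close> if \<open>c s t = 2\<close>; neither is trivial.\<close>

lemma fold_fire_alt_word_neq_id: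
  assumes "s \<noteq> t" "c t s = c s t" "d > 0"
    and c: "c s t = 2 \<or> (\<exists>k > d. c s t = 2 * cos (pi / real k))"
  obtains f where "fold (fire c) (alt_word (2 * d) s t) f \<noteq> f"
proof -
  \<comment> \<open>For the indicator of \<open>s\<close>, the coordinates \<open>s\<close> and
    \<open>t\<close> after \<open>2 * d\<close> moves are \<open>U (2 * d + 1)\<close> and
    \<open>- U (2 * d)\<close>; a trivial action would make them 1 and 0.\<close>
  define f where "f = (\<lambda>r. if r = s then 1 else 0 :: real)"
  have f: "f s = 1" "f t = 0" using \<open>s \<noteq> t\<close> by (auto simp: f_def)
  have "fold (fire c) (alt_word (2 * d) s t) f \<noteq> f"
  proof
    assume eq: "fold (fire c) (alt_word (2 * d) s t) f = f"
    from c show False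
    proof
      assume "c s t = 2"
      then show False
        using fold_fire_alt_word[where U = real and d = d and f = f, OF assms(1,2)] eq f \<open>d > 0\<close>
        by simp
    next
      assume "\<exists>k > d. c s t = 2 * cos (pi / real k)"
      then obtain k where k: "k > d" "c s t = 2 * cos (pi / real k)" by blast
      define \<theta> where "\<theta> = pi / real k"
      have \<theta>: "0 < \<theta>" "\<theta> < pi" "real d * \<theta> < pi" "0 < real d * \<theta>"
        using k(1) \<open>d > 0\<close> by (auto simp: \<theta>_def field_simps)
      have sin: "sin \<theta> > 0" "sin (real d * \<theta>) > 0"
        using \<theta> by (auto intro: sin_gt_zero)
      define U where "U = (\<lambda>n. sin (real n * \<theta>) / sin \<theta>)"
      have U: "U 0 = 0" "U (Suc 0) = 1" "U (Suc (Suc n)) = c s t * U (Suc n) - U n" for n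
        using sin sin_recursion[of n \<theta>] k(2)
        by (simp_all add: U_def \<theta>_def[symmetric] diff_divide_distrib)
      have "U (2 * d) = 0" "U (2 * d + 1) = 1"
        using fold_fire_alt_word[where U = U and d = d and f = f, OF assms(1,2) U] eq f by simp_all
      then have 0: "sin (2 * (real d * \<theta>)) = 0" and 1: "sin (2 * (real d * \<theta>) + \<theta>) = sin \<theta>"
        using sin by (simp_all add: U_def field_simps)
      from 1 have "cos (2 * (real d * \<theta>)) * sin \<theta> = sin \<theta>"
        by (simp add: sin_add 0)
      then have "cos (2 * (real d * \<theta>)) = 1" using sin by simp
      then show False using sin by (simp add: cos_double_sin)
    qed
  qed
  then show ?thesis by (rule that)
qed


section \<open>Words in a Coxeter group\<close>

declare in_listsD [rule del] in_listsI [rule del] alt_word_in_lists [simp]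

locale coxeter = group W for W :: "'w monoid" (structure) +
  fixes S :: "'w set" and m :: "'w \<Rightarrow> 'w \<Rightarrow> enat"
  assumes system: "coxeter_system W S m"
begin

lemma S_carrier: "s \<in> S \<Longrightarrow> s \<in> carrier W"
  and m_sym: "s \<in> S \<Longrightarrow> t \<in> S \<Longrightarrow> s \<noteq> t \<Longrightarrow> m s t = m t s"
  and m_ge_2: "s \<in> S \<Longrightarrow> t \<in> S \<Longrightarrow> s \<noteq> t \<Longrightarrow> 2 \<le> m s t"
  and generate_S: "generate W S = carrier W"
  using system by (auto simp: coxeter_system_def has_presentation_def)

abbreviation wp :: "'w list \<Rightarrow> 'w" where
  "wp \<equiv> word_prod W"

lemma wp_Nil [simp]: "wp [] = \<one>"
  and wp_Cons [simp]: "wp (s # u) = s \<otimes> wp u"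
  by (simp_all add: word_prod_def)

lemma wp_closed [simp]: "u \<in> lists S \<Longrightarrow> wp u \<in> carrier W"
  by (induction u) (auto simp: S_carrier)

lemma wp_append [simp]: "u \<in> lists S \<Longrightarrow> v \<in> lists S \<Longrightarrow> wp (u @ v) = wp u \<otimes> wp v"
  by (induction u) (auto simp: S_carrier m_assoc)

lemma signed_eval_pos_word: "signed_eval W (pos_word u) = wp u"
  by (induction u) (auto simp: signed_eval_def)

lemma pos_word_in_lists: "u \<in> lists S \<Longrightarrow> pos_word u \<in> lists (S \<times> UNIV)"
  by (auto simp: in_lists_conv_set)

lemma signed_eval_eq_iff:
  "u \<in> lists (S \<times> UNIV) \<Longrightarrow> v \<in> lists (S \<times> UNIV) \<Longrightarrow>
    signed_eval W u = signed_eval W v \<longleftrightarrow> equivclp (pres_step S (coxeter_relations S m)) u v"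
  using system by (auto simp: coxeter_system_def has_presentation_def)

lemma relation_wp_eq:
  assumes "(pos_word u, pos_word v) \<in> coxeter_relations S m" "u \<in> lists S" "v \<in> lists S"
  shows "wp u = wp v"
proof -
  have "pres_step S (coxeter_relations S m) (pos_word u) (pos_word v)"
    using pres_step.rel[of "[]" S "[]", OF _ _ assms(1)] by simp
  then have "signed_eval W (pos_word u) = signed_eval W (pos_word v)"
    using assms by (subst signed_eval_eq_iff) (auto intro: pos_word_in_lists)
  then show ?thesis by (simp add: signed_eval_pos_word)
qed

lemma S_square [simp]: "s \<in> S \<Longrightarrow> s \<otimes> s = \<one>"
  using relation_wp_eq[of "[s, s]" "[]"] by (auto simp: coxeter_relations_def S_carrier)

lemma S_square_left [simp]: "s \<in> S \<Longrightarrow> x \<in> carrier W \<Longrightarrow> s \<otimes> (s \<otimes> x) = x"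
  by (simp add: S_carrier m_assoc[symmetric])

lemma inv_S [simp]: "s \<in> S \<Longrightarrow> inv s = s"
  by (simp add: S_carrier inv_equality)

lemma wp_braid:
  "s \<in> S \<Longrightarrow> t \<in> S \<Longrightarrow> s \<noteq> t \<Longrightarrow> m s t = enat k \<Longrightarrow> wp (alt_word k s t) = wp (alt_word k t s)"
  by (rule relation_wp_eq) (auto simp: coxeter_relations_def intro: alt_word_in_lists)

lemma rev_in_lists [simp]: "rev u \<in> lists A \<longleftrightarrow> u \<in> lists A"
  by (simp add: in_lists_conv_set)

lemma wp_rev: "u \<in> lists S \<Longrightarrow> wp (rev u) = inv (wp u)"
  by (induction u) (auto simp: S_carrier inv_mult_group)

lemma obtain_word:
  assumes "x \<in> carrier W"
  obtains u where "u \<in> lists S" "wp u = x"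
proof -
  from assms have "x \<in> generate W S" by (simp add: generate_S)
  then have "\<exists>u \<in> lists S. wp u = x"
  proof induction
    case one
    show ?case by (rule bexI[of _ "[]"]) auto
  next
    case (incl h)
    then show ?case by (intro bexI[of _ "[h]"]) (auto simp: S_carrier)
  next
    case (inv h)
    then show ?case by (intro bexI[of _ "[h]"]) (auto simp: S_carrier)
  next
    case (eng h1 h2)
    then obtain u v where "u \<in> lists S" "wp u = h1" "v \<in> lists S" "wp v = h2" by blast
    then show ?case by (intro bexI[of _ "u @ v"]) auto
  qed
  with that show ?thesis by blast
qed

section \<open>Functions of words that descend to the group\<close>

text \<open>Cancellation of squares is deliberately left out: this is the hypothesis of Matsumoto's
  theorem, which compares reduced words only.\<close>

definition braid_invariant :: "('w list \<Rightarrow> 'b) \<Rightarrow> bool" where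
  "braid_invariant F \<longleftrightarrow> (\<forall>p \<in> lists S. \<forall>r \<in> lists S. \<forall>s \<in> S. \<forall>t \<in> S. \<forall>k.
     s \<noteq> t \<and> m s t = enat k \<longrightarrow> F (p @ alt_word k s t @ r) = F (p @ alt_word k t s @ r))"

text \<open>Words with the same product are joined by a chain of presentation steps. Forgetting the
  signs with \<open>map fst\<close> keeps this chain usable, because cancelling a letter against its
  formal inverse becomes the deletion of a square.\<close>

lemma word_invariant:
  assumes square: "\<And>p r s. p \<in> lists S \<Longrightarrow> r \<in> lists S \<Longrightarrow> s \<in> S \<Longrightarrow> F (p @ [s, s] @ r) = F (p @ r)"
    and braid: "braid_invariant F"
    and "u \<in> lists S" "v \<in> lists S" "wp u = wp v"
  shows "F u = F v"
proof -
  let ?R = "coxeter_relations S m"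
  have step: "F (map fst x) = F (map fst y)" if "pres_step S ?R x y" for x y
    using that
  proof cases
    case (cancel p r s b)
    then have "map fst p \<in> lists S" "map fst r \<in> lists S" by (auto simp: in_lists_conv_set)
    with cancel square[of "map fst p" "map fst r" s] show ?thesis by simp
  next
    case (rel p r a b)
    then have pr: "map fst p \<in> lists S" "map fst r \<in> lists S" by (auto simp: in_lists_conv_set)
    from rel(5) consider s where "s \<in> S" "a = pos_word [s, s]" "b = []"
      | s t k where "s \<in> S" "t \<in> S" "s \<noteq> t" "m s t = enat k"
          "a = pos_word (alt_word k s t)" "b = pos_word (alt_word k t s)"
      by (auto simp: coxeter_relations_def)
    then show ?thesis
    proof cases
      case 1
      with rel pr square[of "map fst p" "map fst r" s] show ?thesis by simp
    next
      case 2
      with rel pr show ?thesis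
        using braid[unfolded braid_invariant_def, rule_format, of "map fst p" "map fst r" s t k]
        by (simp add: comp_def)
    qed
  qed
  have "equivclp (pres_step S ?R) (pos_word u) (pos_word v)"
    using assms(3-5) signed_eval_eq_iff[of "pos_word u" "pos_word v"]
    by (simp add: signed_eval_pos_word pos_word_in_lists)
  then have "F (map fst (pos_word u)) = F (map fst (pos_word v))"
    unfolding equivclp_def
    by (induction rule: rtranclp_induct) (auto simp: symclp_def dest: step)
  then show ?thesis by (simp add: comp_def)
qed


section \<open>The order of a product of two generators\<close>

text \<open>The off-diagonal entries are minus twice the standard bilinear form; 2 is the limit of
  the cosine values as \<open>k\<close> grows.\<close>

definition cartan :: "'w \<Rightarrow> 'w \<Rightarrow> real" where
  "cartan s t = (case m s t of enat k \<Rightarrow> 2 * cos (pi / real k) | \<infinity> \<Rightarrow> 2)"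

lemma fold_fire_wp_eq:
  assumes "u \<in> lists S" "v \<in> lists S" "wp u = wp v"
  shows "fold (fire cartan) u = fold (fire cartan) v"
proof (rule word_invariant[OF _ _ assms])
  show "braid_invariant (fold (fire cartan))"
    unfolding braid_invariant_def
  proof (intro ballI allI impI, elim conjE)
    fix p r :: "'w list" and s t k
    assume st: "s \<in> S" "t \<in> S" "s \<noteq> t" "m s t = enat k"
    then have "k \<ge> 2" using m_ge_2[of s t] by (simp add: numeral_eq_enat)
    moreover have "cartan t s = cartan s t" "cartan s t = 2 * cos (pi / real k)"
      using st m_sym[of s t] by (simp_all add: cartan_def)
    ultimately have "fold (fire cartan) (alt_word k s t) = fold (fire cartan) (alt_word k t s)"
      using fold_fire_braid[of s t cartan k] st by blast
    then show "fold (fire cartan) (p @ alt_word k s t @ r) = fold (fire cartan) (p @ alt_word k t s @ r)"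
      by simp
  qed
qed (auto simp: fun_eq_iff)

text \<open>By \<open>fold_fire_wp_eq\<close> the group acts through the numbers game, and there
  this word moves some position. So the defining relations do not collapse the order of
  \<open>s t\<close> below \<open>m s t\<close>.\<close>

lemma alt_word_neq_one:
  assumes "s \<in> S" "t \<in> S" "s \<noteq> t" "0 < d" "enat d < m s t"
  shows "wp (alt_word (2 * d) s t) \<noteq> \<one>"
proof
  assume eq: "wp (alt_word (2 * d) s t) = \<one>"
  have "cartan t s = cartan s t"
    using assms m_sym[of s t] by (simp add: cartan_def)
  moreover have "cartan s t = 2 \<or> (\<exists>k > d. cartan s t = 2 * cos (pi / real k))"
    using assms(5) by (cases "m s t") (auto simp: cartan_def)
  ultimately obtain f where "fold (fire cartan) (alt_word (2 * d) s t) f \<noteq> f"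
    using fold_fire_alt_word_neq_id[of s t cartan d] assms(3,4) by blast
  moreover have "fold (fire cartan) (alt_word (2 * d) s t) = fold (fire cartan) []"
    using eq assms(1,2) by (intro fold_fire_wp_eq alt_word_in_lists) auto
  ultimately show False by simp
qed


section \<open>Reflections and reduced words\<close>

fun reflections :: "'w list \<Rightarrow> 'w list" where
  "reflections [] = []"
| "reflections (s # u) = s # map (\<lambda>t. s \<otimes> t \<otimes> s) (reflections u)"

lemma refl_closed: "u \<in> lists S \<Longrightarrow> t \<in> set (reflections u) \<Longrightarrow> t \<in> carrier W"
  by (induction u arbitrary: t) (auto simp: S_carrier)

lemma length_refl [simp]: "length (reflections u) = length u"
  by (induction u) auto

lemma conj_eq_iff [simp]:
  "s \<in> S \<Longrightarrow> x \<in> carrier W \<Longrightarrow> y \<in> carrier W \<Longrightarrow> s \<otimes> x \<otimes> s = s \<otimes> y \<otimes> s \<longleftrightarrow> x = y"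
  by (simp add: S_carrier)

lemma eq_conj_self_iff [simp]:
  assumes "s \<in> S" "t \<in> carrier W"
  shows "s = s \<otimes> t \<otimes> s \<longleftrightarrow> t = s"
  using conj_eq_iff[of s s t] assms by (auto simp: S_carrier simp del: conj_eq_iff)

lemma refl_append:
  assumes "u \<in> lists S" "v \<in> lists S"
  shows "reflections (u @ v) = reflections u @ map (\<lambda>t. wp u \<otimes> t \<otimes> inv (wp u)) (reflections v)"
  using assms(1)
proof (induction u)
  case Nil
  show ?case using refl_closed[OF assms(2)] by (auto intro!: map_idI[symmetric])
next
  case (Cons s u)
  then show ?case using refl_closed[OF assms(2)]
    by (auto simp: S_carrier inv_mult_group m_assoc)
qed

text \<open>An alternating word of odd length is a palindrome, so its product is its own
  inverse.\<close>

lemma wp_alt_word_odd_eq: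
  assumes "s \<in> S" "t \<in> S" "odd i" "odd j" "wp (alt_word (i + j) s t) = \<one>"
  shows "wp (alt_word i s t) = wp (alt_word j t s)"
proof -
  have l: "alt_word i s t \<in> lists S" "alt_word j t s \<in> lists S"
    using assms by (auto intro: alt_word_in_lists)
  have "wp (alt_word i s t) \<otimes> wp (alt_word j t s) = \<one>"
    using assms l by (simp add: alt_word_add)
  then have "wp (alt_word i s t) = inv (wp (alt_word j t s))"
    using l by (simp add: inv_equality)
  also have "\<dots> = wp (rev (alt_word j t s))"
    using l by (simp add: wp_rev)
  also have "rev (alt_word j t s) = alt_word j t s"
    using assms by (simp add: rev_alt_word)
  finally show ?thesis .
qed

text \<open>Conjugating letter number \<open>i\<close> (from 0) by the alternating prefix before it
  spells an alternating palindrome with \<open>2 * i + 1\<close> letters.\<close>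

lemma refl_alt_word:
  assumes "s \<in> S" "t \<in> S"
  shows "reflections (alt_word k s t) = map (\<lambda>i. wp (alt_word (2 * i + 1) s t)) [0..<k]"
  using assms
proof (induction k arbitrary: s t)
  case (Suc k)
  have "s \<otimes> wp (alt_word (2 * i + 1) t s) \<otimes> s = wp (alt_word (2 * Suc i + 1) s t)" for i
  proof -
    have "alt_word (2 * Suc i + 1) s t = s # alt_word (2 * i + 1) t s @ [s]"
      using alt_word_Suc_right[of "2 * Suc i" s t] by (simp add: alt_word_Suc_right)
    then show ?thesis
      using Suc.prems alt_word_in_lists[of t S s] by (simp add: S_carrier m_assoc del: alt_word.simps)
  qed
  then have "map (\<lambda>x. s \<otimes> x \<otimes> s) (reflections (alt_word k t s))
      = map (\<lambda>i. wp (alt_word (2 * i + 1) s t)) (map Suc [0..<k])"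
    using Suc by simp
  moreover have "[0..<Suc k] = 0 # map Suc [0..<k]"
    by (simp add: upt_conv_Cons map_Suc_upt)
  moreover have "wp (alt_word (2 * 0 + 1) s t) = s" using Suc.prems by (simp add: S_carrier)
  ultimately show ?case by simp
qed simp

text \<open>Entries \<open>i\<close> and \<open>k - Suc i\<close> of the two lists are odd
  alternating words whose lengths add up to \<open>2 * k\<close>; since \<open>(ts)^k = 1\<close>,
  they have the same product.\<close>

lemma refl_braid:
  assumes "s \<in> S" "t \<in> S" "s \<noteq> t" "m s t = enat k"
  shows "reflections (alt_word k t s) = rev (reflections (alt_word k s t))"
proof (rule nth_equalityI)
  fix i assume "i < length (reflections (alt_word k t s))"
  then have i: "i < k" by simp
  have one: "wp (alt_word (2 * k) t s) = \<one>"
    using wp_braid[OF assms] assms alt_word_in_lists[of _ S _ k]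
    by (simp add: alt_word_double wp_rev)
  have "2 * i + 1 + (2 * (k - Suc i) + 1) = 2 * k" using i by simp
  then have "wp (alt_word (2 * i + 1) t s) = wp (alt_word (2 * (k - Suc i) + 1) s t)"
    using one assms by (intro wp_alt_word_odd_eq) (simp_all only: odd_add, simp_all)
  then show "reflections (alt_word k t s) ! i = rev (reflections (alt_word k s t)) ! i"
    using i assms by (simp add: refl_alt_word rev_nth del: alt_word.simps)
qed simp

definition refl_parity :: "'w list \<Rightarrow> 'w \<Rightarrow> bool" where
  "refl_parity u t = odd (count (mset (reflections u)) t)"

text \<open>Inserting \<open>s s\<close> inserts one reflection twice, and a braid move only
  permutes the reflections of the subword that it changes. The other reflections stay the same
  because the product of that subword does.\<close>

lemma refl_parity_wp_eq:
  assumes "u \<in> lists S" "v \<in> lists S" "wp u = wp v"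
  shows "refl_parity u = refl_parity v"
proof -
  show ?thesis
  proof (rule word_invariant[OF _ _ assms])
    fix p r s assume *: "p \<in> lists S" "r \<in> lists S" "s \<in> S"
    then have "reflections (s # s # r) = s # s # reflections r"
      using refl_closed[OF *(2)] by (auto simp: S_carrier m_assoc intro!: map_idI)
    with * show "refl_parity (p @ [s, s] @ r) = refl_parity (p @ r)"
      by (simp add: refl_parity_def fun_eq_iff refl_append del: reflections.simps)
  next
    show "braid_invariant refl_parity"
      unfolding braid_invariant_def
    proof (intro ballI allI impI, elim conjE)
      fix p r :: "'w list" and s t k
      assume *: "p \<in> lists S" "r \<in> lists S" "s \<in> S" "t \<in> S" "s \<noteq> t" "m s t = enat k"
      then have "wp (alt_word k s t) = wp (alt_word k t s)" "alt_word k s t \<in> lists S" "alt_word k t s \<in> lists S"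
        "mset (reflections (alt_word k s t)) = mset (reflections (alt_word k t s))"
        using wp_braid by (auto simp: refl_braid intro: alt_word_in_lists)
      then show "refl_parity (p @ alt_word k s t @ r) = refl_parity (p @ alt_word k t s @ r)"
        using * by (simp add: refl_parity_def fun_eq_iff refl_append del: count_mset)
    qed
  qed
qed

section \<open>Reduced words and the exchange property\<close>

definition red :: "'w list \<Rightarrow> bool" where
  "red u \<longleftrightarrow> u \<in> lists S \<and> (\<forall>v \<in> lists S. wp v = wp u \<longrightarrow> length u \<le> length v)"

lemma red_lists: "red u \<Longrightarrow> u \<in> lists S"
  by (simp add: red_def)

lemma red_ConsD: "red (s # u) \<Longrightarrow> red u"
  unfolding red_def
proof (intro conjI ballI impI)
  fix v assume *: "s # u \<in> lists S \<and> (\<forall>v\<in>lists S. wp v = wp (s # u) \<longrightarrow> length (s # u) \<le> length v)"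
    "v \<in> lists S" "wp v = wp u"
  then show "length u \<le> length v"
    using spec[of "\<lambda>v. v\<in>lists S \<longrightarrow> wp v = wp (s # u) \<longrightarrow> length (s # u) \<le> length v" "s # v"] by auto
qed auto

text \<open>If \<open>t\<close> is a prefix conjugate of some letter of \<open>u\<close>,
  multiplying by \<open>t\<close> on the left cancels exactly that letter.\<close>

lemma refl_delete:
  assumes "u \<in> lists S" "t \<in> set (reflections u)"
  obtains v where "v \<in> lists S" "length u = Suc (length v)" "t \<otimes> wp u = wp v"
proof -
  from assms have "\<exists>v \<in> lists S. length u = Suc (length v) \<and> t \<otimes> wp u = wp v"
  proof (induction u arbitrary: t)
    case (Cons s u)
    then have s: "s \<in> S" "u \<in> lists S" by auto
    from Cons.prems consider "t = s" | t' where "t' \<in> set (reflections u)" "t = s \<otimes> t' \<otimes> s" by auto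
    then show ?case
    proof cases
      case 1
      then show ?thesis using s by (intro bexI[of _ u]) auto
    next
      case 2
      with Cons obtain v where v: "v \<in> lists S" "length u = Suc (length v)" "t' \<otimes> wp u = wp v"
        by auto
      have "t \<otimes> wp (s # u) = s \<otimes> (t' \<otimes> wp u)"
        using 2 s refl_closed by (simp add: S_carrier m_assoc)
      then show ?thesis using v s by (intro bexI[of _ "s # v"]) auto
    qed
  qed simp
  with that show ?thesis by blast
qed

lemma refl_parity_distinct: "distinct (reflections u) \<Longrightarrow> refl_parity u t \<longleftrightarrow> t \<in> set (reflections u)"
  by (simp add: refl_parity_def distinct_count_atmost_1)

text \<open>Distinct reflections have odd multiplicity, so they occur in every word for the same
  element, which is then at least as long. Conversely, a first repetition at the front means that
  \<open>s\<close> is already a reflection of the tail, and \<open>refl_delete\<close> shortens the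
  word.\<close>

lemma red_iff_distinct: "u \<in> lists S \<Longrightarrow> red u \<longleftrightarrow> distinct (reflections u)"
proof
  assume u: "u \<in> lists S" and d: "distinct (reflections u)"
  show "red u"
    unfolding red_def
  proof (intro conjI u ballI impI)
    fix v assume v: "v \<in> lists S" "wp v = wp u"
    have "set (reflections u) \<subseteq> set (reflections v)"
    proof
      fix t assume "t \<in> set (reflections u)"
      then have "refl_parity v t"
        using refl_parity_wp_eq[OF v(1) u v(2)] refl_parity_distinct[OF d] by simp
      then show "t \<in> set (reflections v)"
        unfolding refl_parity_def by (metis count_mset_0_iff even_zero)
    qed
    then have "card (set (reflections u)) \<le> card (set (reflections v))" by (simp add: card_mono)
    also have "\<dots> \<le> length v" using card_length[of "reflections v"] by simp
    finally show "length u \<le> length v" using distinct_card[OF d] by simp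
  qed
next
  assume "u \<in> lists S" "red u"
  then show "distinct (reflections u)"
  proof (induction u)
    case (Cons s u)
    then have s: "s \<in> S" "u \<in> lists S" "red u" "distinct (reflections u)" by (auto dest: red_ConsD)
    have inj: "inj_on (\<lambda>t. s \<otimes> t \<otimes> s) (set (reflections u))"
      using s refl_closed by (auto intro!: inj_onI)
    moreover have "s \<noteq> s \<otimes> t \<otimes> s" if t: "t \<in> set (reflections u)" for t
    proof
      assume "s = s \<otimes> t \<otimes> s"
      then have "t = s" using s refl_closed[OF s(2) t] by simp
      with t obtain v where "v \<in> lists S" "length u = Suc (length v)" "s \<otimes> wp u = wp v"
        using refl_delete[OF s(2)] by blast
      with Cons.prems show False unfolding red_def by force
    qed
    ultimately show ?case using s by (auto simp: distinct_map)
  qed simp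
qed

text \<open>Conjugation by \<open>s\<close> is injective and fixes \<open>s\<close>, so prepending
  \<open>s\<close> creates a repeated reflection only if \<open>s\<close> is already among those of
  \<open>u\<close>.\<close>

lemma exchange:
  assumes "red u" "s \<in> S"
  shows "red (s # u) \<or> s \<in> set (reflections u)"
proof -
  have u: "u \<in> lists S" "distinct (reflections u)" using assms red_lists red_iff_distinct by auto
  have "t = s" if "t \<in> set (reflections u)" "s = s \<otimes> t \<otimes> s" for t
    using that assms refl_closed[OF u(1)] by simp
  moreover have "inj_on (\<lambda>t. s \<otimes> t \<otimes> s) (set (reflections u))"
    using u refl_closed assms by (auto intro!: inj_onI)
  ultimately have "s \<notin> set (reflections u) \<Longrightarrow> distinct (reflections (s # u))"
    using u by (auto simp: distinct_map)
  then show ?thesis using red_iff_distinct[of "s # u"] u assms by auto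
qed

text \<open>Two equal reflections at positions \<open>i < j\<close> would give
  \<open>(ts)^d = 1\<close> for \<open>d = j - i\<close>, which lies strictly between 0 and
  \<open>m s t\<close>.\<close>

lemma red_alt_word:
  assumes "s \<in> S" "t \<in> S" "s \<noteq> t" "enat k \<le> m s t"
  shows "red (alt_word k s t)"
proof -
  have "wp (alt_word (2 * i + 1) s t) \<noteq> wp (alt_word (2 * j + 1) s t)" if "i < j" "j < k" for i j
  proof
    assume eq: "wp (alt_word (2 * i + 1) s t) = wp (alt_word (2 * j + 1) s t)"
    define d where "d = j - i"
    have d: "0 < d" "2 * j + 1 = (2 * i + 1) + 2 * d" "enat d < m t s"
      using that assms(4) m_sym[OF assms(1-3)] by (auto simp: d_def intro: less_le_trans[of _ "enat k"])
    have l: "alt_word (2 * i + 1) s t \<in> lists S" "alt_word (2 * d) t s \<in> lists S"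
      using assms by (auto intro!: alt_word_in_lists simp del: alt_word.simps)
    have "alt_word (2 * j + 1) s t = alt_word (2 * i + 1) s t @ alt_word (2 * d) t s"
      using alt_word_add[of "2 * i + 1" "2 * d" s t] by (simp only: d(2)) simp
    then have "wp (alt_word (2 * j + 1) s t) = wp (alt_word (2 * i + 1) s t) \<otimes> wp (alt_word (2 * d) t s)"
      using wp_append[OF l] by (simp only:)
    then have "wp (alt_word (2 * d) t s) = \<one>" using eq l by (metis l_cancel_one' wp_closed)
    with alt_word_neq_one[of t s d] d assms show False by auto
  qed
  then have "distinct (reflections (alt_word k s t))"
    using assms(1,2) by (auto simp: refl_alt_word distinct_map inj_on_def simp del: alt_word.simps)
      (metis nat_neq_iff)
  then show ?thesis using assms by (simp add: red_iff_distinct alt_word_in_lists)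
qed

end


context coxeter
begin

section \<open>Matsumoto's theorem\<close>

lemma red_length_eq: "red u \<Longrightarrow> red v \<Longrightarrow> wp u = wp v \<Longrightarrow> length u = length v"
  by (metis red_def order_antisym)

lemma red_transfer: "red u \<Longrightarrow> v \<in> lists S \<Longrightarrow> wp v = wp u \<Longrightarrow> length v = length u \<Longrightarrow> red v"
  unfolding red_def by simp

text \<open>The word \<open>t # v\<close> shows that \<open>t\<close> is a reflection of the
  element. It does not come from the alternating prefix, which stays reduced with \<open>t\<close>
  in front; so it comes from \<open>z\<close>, and multiplying by \<open>t\<close> deletes a letter
  of \<open>z\<close>.\<close>

lemma red_alt_word_extend:
  assumes st: "s \<in> S" "t \<in> S" "s \<noteq> t" "enat (Suc j) \<le> m s t"
    and red: "red (alt_word j s t @ z)" "red (t # v)"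
    and eq: "wp (t # v) = wp (alt_word j s t @ z)"
  shows "\<exists>z'. red (alt_word (Suc j) t s @ z') \<and> wp (alt_word (Suc j) t s @ z') = wp (alt_word j s t @ z)"
proof -
  let ?a = "alt_word j s t"
  have l: "?a \<in> lists S" "z \<in> lists S" "v \<in> lists S" using red st by (auto dest: red_lists)
  have red_Suc: "red (t # ?a)"
    using red_alt_word[of t s "Suc j"] st m_sym[of s t] by simp
  have "refl_parity (t # v) t"
    using red(2) l st by (subst refl_parity_distinct) (auto simp: red_iff_distinct)
  then have "refl_parity (?a @ z) t"
    using refl_parity_wp_eq[OF _ _ eq] l st by simp
  then have "t \<in> set (reflections (?a @ z))"
    using red(1) l by (subst (asm) refl_parity_distinct) (auto simp: red_iff_distinct)
  moreover have "t \<notin> set (reflections ?a)"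
  proof
    assume "t \<in> set (reflections ?a)"
    then obtain y where "y \<in> lists S" "length ?a = Suc (length y)" "t \<otimes> wp ?a = wp y"
      using refl_delete[OF l(1)] by blast
    with red_Suc show False unfolding red_def by force
  qed
  ultimately obtain t' where t': "t' \<in> set (reflections z)" "t = wp ?a \<otimes> t' \<otimes> inv (wp ?a)"
    using l by (auto simp: refl_append)
  then obtain z' where z': "z' \<in> lists S" "length z = Suc (length z')" "t' \<otimes> wp z = wp z'"
    using refl_delete[OF l(2)] by blast
  have "t \<otimes> wp (?a @ z) = wp ?a \<otimes> t' \<otimes> inv (wp ?a) \<otimes> wp (?a @ z)"
    by (rule arg_cong[OF t'(2), of "\<lambda>x. x \<otimes> wp (?a @ z)"])
  also have "\<dots> = wp ?a \<otimes> (t' \<otimes> wp z)"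
  proof -
    have "inv (wp ?a) \<otimes> (wp ?a \<otimes> wp z) = wp z"
      using l by (simp add: m_assoc[symmetric])
    then show ?thesis
      using l refl_closed[OF l(2) t'(1)] by (simp add: m_assoc)
  qed
  also have "\<dots> = wp (?a @ z')" using l z' by simp
  finally have "t \<otimes> (t \<otimes> wp (?a @ z)) = t \<otimes> wp (?a @ z')" by simp
  then have "wp (alt_word (Suc j) t s @ z') = wp (?a @ z)"
    using st l by simp
  moreover from this have "red (alt_word (Suc j) t s @ z')"
    using z' st by (intro red_transfer[OF red(1)]) auto
  ultimately show ?thesis by blast
qed

text \<open>Both kinds of prefix grow together: prepending \<open>t\<close> to the prefix starting
  with \<open>s\<close> gives the next prefix starting with \<open>t\<close>, and vice
  versa.\<close>

lemma red_alt_word_prefix: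
  assumes st: "s \<in> S" "t \<in> S" "s \<noteq> t" "enat j \<le> m s t"
    and red: "red (s # u)" "red (t # v)" and eq: "wp (s # u) = wp (t # v)"
  shows "(\<exists>z. red (alt_word j s t @ z) \<and> wp (alt_word j s t @ z) = wp (s # u)) \<and>
    (\<exists>z. red (alt_word j t s @ z) \<and> wp (alt_word j t s @ z) = wp (s # u))"
  using st(4)
proof (induction j)
  case 0
  show ?case using red by (intro conjI exI[of _ "s # u"]) auto
next
  case (Suc j)
  have "enat j \<le> m s t" using Suc.prems by (rule order_trans[rotated]) simp
  with Suc.IH obtain y z where
    "red (alt_word j s t @ y)" "wp (alt_word j s t @ y) = wp (s # u)"
    "red (alt_word j t s @ z)" "wp (alt_word j t s @ z) = wp (s # u)" by blast
  then show ?case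
    using red_alt_word_extend[OF st(1-3) Suc.prems _ red(2), of y]
      red_alt_word_extend[OF st(2,1) st(3)[symmetric] _ _ red(1), of j z] Suc.prems m_sym[OF st(1-3)] eq
    by auto
qed

text \<open>Words with the same first letter are compared by induction on their tails. Otherwise
  both are compared with reduced words that start with the two sides of the braid relation for
  \<open>s\<close> and \<open>t\<close>; these two words differ by one braid move.\<close>

theorem matsumoto:
  assumes "braid_invariant F" "red u" "red v" "wp u = wp v"
  shows "F u = F v"
  using assms
proof (induction "length u" arbitrary: F u v)
  case 0
  then show ?case using red_length_eq[of u v] by simp
next
  case (Suc n)
  \<comment> \<open>Stripping the first letter changes the function to
    \<open>\<lambda>w. F (a # w)\<close>, hence the induction with \<open>F\<close>
    arbitrary.\<close>
  have tail: "F (a # x) = F (a # y)"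
    if "red (a # x)" "red (a # y)" "wp (a # x) = wp (a # y)" "length (a # x) = Suc n" for a x y
  proof (rule Suc.hyps(1)[of x "\<lambda>w. F (a # w)" y])
    have a: "a \<in> S" "x \<in> lists S" "y \<in> lists S" using that by (auto dest: red_lists)
    show "braid_invariant (\<lambda>w. F (a # w))"
      unfolding braid_invariant_def
    proof (intro ballI allI impI)
      fix p r s t k
      assume "p \<in> lists S" "r \<in> lists S" "s \<in> S" "t \<in> S" "s \<noteq> t \<and> m s t = enat k"
      then show "F (a # p @ alt_word k s t @ r) = F (a # p @ alt_word k t s @ r)"
        using Suc.prems(1)[unfolded braid_invariant_def, rule_format, of "a # p" r s t k] a by simp
    qed
    show "wp x = wp y" using that(3) a by (simp add: S_carrier)
  qed (use that in \<open>auto dest: red_ConsD\<close>)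
  obtain s u' where u: "u = s # u'" using Suc.hyps(2) by (cases u) auto
  have "length v = Suc n" using red_length_eq Suc by metis
  then obtain t v' where v: "v = t # v'" by (cases v) auto
  have st: "s \<in> S" "t \<in> S" "u \<in> lists S" using Suc.prems u v by (auto dest: red_lists)
  show ?case
  proof (cases "s = t")
    case True
    then show ?thesis using tail[of s u' v'] Suc.prems Suc.hyps(2) u v by simp
  next
    case False
    note prefix = red_alt_word_prefix[OF st(1,2) False _ Suc.prems(2,3)[unfolded u v] Suc.prems(4)[unfolded u v]]
    \<comment> \<open>An alternating prefix of \<open>n + 2\<close> letters does not fit into a word
      of length \<open>n + 1\<close>; in particular \<open>m s t\<close> is finite.\<close>
    have "\<not> enat (Suc (Suc n)) \<le> m s t"
    proof
      assume "enat (Suc (Suc n)) \<le> m s t"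
      from prefix[OF this] obtain z where
        z: "red (alt_word (Suc (Suc n)) s t @ z)" "wp (alt_word (Suc (Suc n)) s t @ z) = wp u"
        unfolding u by blast
      show False using red_length_eq[OF z(1) Suc.prems(2) z(2)] Suc.hyps(2) by simp
    qed
    then obtain k where k: "m s t = enat k" by (cases "m s t") auto
    then have "k \<ge> 2" using m_ge_2[OF st(1,2) False] by (simp add: numeral_eq_enat)
    then obtain k' where k': "k = Suc k'" by (cases k) auto
    from prefix[of k] k obtain z where
      z: "red (alt_word k s t @ z)" "wp (alt_word k s t @ z) = wp u"
      unfolding u by auto
    then have zS: "z \<in> lists S" by (auto dest: red_lists)
    have z': "wp (alt_word k t s @ z) = wp u"
      using z(2) wp_braid[OF st(1,2) False k] zS st by simp
    then have "red (alt_word k t s @ z)"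
      using z zS st by (intro red_transfer[OF z(1)]) simp_all
    have "F u = F (alt_word k s t @ z)"
      using tail[of s u' "alt_word k' t s @ z"] z Suc.prems Suc.hyps(2) u by (simp add: k')
    also have "\<dots> = F (alt_word k t s @ z)"
      using Suc.prems(1)[unfolded braid_invariant_def, rule_format, of "[]" z s t k] zS st False k by simp
    also have "\<dots> = F v"
      using tail[of t v' "alt_word k' s t @ z"] z' \<open>red (alt_word k t s @ z)\<close> Suc.prems
        \<open>length v = Suc n\<close> v by (simp add: k')
    finally show ?thesis .
  qed
qed


section \<open>The length function\<close>

definition len :: "'w \<Rightarrow> nat" where
  "len x = (LEAST n. \<exists>u \<in> lists S. wp u = x \<and> length u = n)"

lemma len_wp_le: "u \<in> lists S \<Longrightarrow> len (wp u) \<le> length u"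
  unfolding len_def by (rule Least_le) auto

lemma obtain_red:
  assumes "x \<in> carrier W"
  obtains u where "red u" "wp u = x" "length u = len x"
proof -
  from assms obtain v where "v \<in> lists S" "wp v = x" by (rule obtain_word)
  then have "\<exists>n. \<exists>u \<in> lists S. wp u = x \<and> length u = n" by blast
  from LeastI_ex[OF this] obtain u where u: "u \<in> lists S" "wp u = x" "length u = len x"
    unfolding len_def by blast
  moreover have "red u"
    unfolding red_def using u len_wp_le by force
  ultimately show ?thesis using that by blast
qed

lemma len_red: "red u \<Longrightarrow> len (wp u) = length u"
  by (metis obtain_red red_length_eq red_lists wp_closed)

lemma red_iff_len: "u \<in> lists S \<Longrightarrow> red u \<longleftrightarrow> len (wp u) = length u"
  by (metis len_red len_wp_le red_def)

lemma reduced_expression_iff: "reduced_expression W S x u \<longleftrightarrow> red u \<and> wp u = x"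
  by (auto simp: reduced_expression_def red_def)

lemma len_mult_le: "x \<in> carrier W \<Longrightarrow> y \<in> carrier W \<Longrightarrow> len (x \<otimes> y) \<le> len x + len y"
proof -
  assume "x \<in> carrier W" "y \<in> carrier W"
  then obtain u v where "red u" "wp u = x" "length u = len x" "red v" "wp v = y" "length v = len y"
    by (metis obtain_red)
  then show ?thesis using len_wp_le[of "u @ v"] by (auto dest: red_lists)
qed

lemma len_S_le: "s \<in> S \<Longrightarrow> len s \<le> 1"
  using len_wp_le[of "[s]"] by (simp add: S_carrier)

lemma length_parity_wp_eq:
  assumes "u \<in> lists S" "v \<in> lists S" "wp u = wp v"
  shows "even (length u) \<longleftrightarrow> even (length v)"
  by (rule word_invariant[OF _ _ assms]) (auto simp: braid_invariant_def)

lemma even_len_wp: "u \<in> lists S \<Longrightarrow> even (len (wp u)) \<longleftrightarrow> even (length u)"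
proof -
  assume u: "u \<in> lists S"
  then obtain v where "red v" "wp v = wp u" "length v = len (wp u)"
    using obtain_red[OF wp_closed] by blast
  then show ?thesis using length_parity_wp_eq[of v u] u red_lists by auto
qed

lemma even_len_mult:
  "x \<in> carrier W \<Longrightarrow> y \<in> carrier W \<Longrightarrow> even (len (x \<otimes> y)) \<longleftrightarrow> (even (len x) \<longleftrightarrow> even (len y))"
proof -
  assume "x \<in> carrier W" "y \<in> carrier W"
  then obtain u v where "u \<in> lists S" "wp u = x" "v \<in> lists S" "wp v = y"
    by (metis obtain_word)
  then show ?thesis using even_len_wp[of "u @ v"] even_len_wp[of u] even_len_wp[of v] by auto
qed

lemma odd_len_S: "s \<in> S \<Longrightarrow> odd (len s)"
  using even_len_wp[of "[s]"] by (simp add: S_carrier)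

lemma len_right:
  assumes "x \<in> carrier W" "s \<in> S"
  shows "len (x \<otimes> s) = Suc (len x) \<or> len x = Suc (len (x \<otimes> s))"
proof -
  have "len (x \<otimes> s) \<le> Suc (len x)" "len x \<le> Suc (len (x \<otimes> s))"
    using len_mult_le[of x s] len_mult_le[of "x \<otimes> s" s] len_S_le[of s] assms
    by (simp_all add: S_carrier m_assoc)
  moreover have "len (x \<otimes> s) \<noteq> len x"
    using even_len_mult[of x s] odd_len_S assms S_carrier by metis
  ultimately show ?thesis by linarith
qed

lemma len_left:
  assumes "x \<in> carrier W" "s \<in> S"
  shows "len (s \<otimes> x) = Suc (len x) \<or> len x = Suc (len (s \<otimes> x))"
proof -
  have "len (s \<otimes> x) \<le> Suc (len x)" "len x \<le> Suc (len (s \<otimes> x))"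
    using len_mult_le[of s x] len_mult_le[of s "s \<otimes> x"] len_S_le[of s] assms
    by (simp_all add: S_carrier)
  moreover have "len (s \<otimes> x) \<noteq> len x"
    using even_len_mult[of s x] odd_len_S assms S_carrier by metis
  ultimately show ?thesis by linarith
qed

text \<open>For a reduced word \<open>u\<close> of \<open>x\<close>, both \<open>t # u\<close> and
  \<open>u @ [s]\<close> are reduced but \<open>t # u @ [s]\<close> is not. By exchange
  \<open>t\<close> is a reflection of \<open>u @ [s]\<close>, and as it is none of \<open>u\<close>
  it is the last one, \<open>x s x^-1\<close>.\<close>

lemma left_eq_right_of_len_less:
  assumes x: "x \<in> carrier W" and st: "s \<in> S" "t \<in> S"
    and len: "len x < len (t \<otimes> x)" "len (x \<otimes> s) = len (t \<otimes> x)" "len (t \<otimes> x \<otimes> s) = len x"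
  shows "t \<otimes> x = x \<otimes> s"
proof -
  obtain u where u: "red u" "wp u = x" "length u = len x" using x by (rule obtain_red)
  have uS: "u \<in> lists S" using u red_lists by blast
  have tx: "len (t \<otimes> x) = Suc (len x)" using len_left[OF x st(2)] len by auto
  have us: "wp (u @ [s]) = x \<otimes> s" using uS u st by (simp add: S_carrier)
  have "red (t # u)" "red (u @ [s])"
    using uS st u len tx us by (simp_all add: red_iff_len)
  moreover have "\<not> red (t # u @ [s])"
    using uS st len us u x by (simp add: red_iff_len S_carrier m_assoc del: wp_append)
  ultimately have "t \<in> set (reflections (u @ [s]))"
    using exchange[of "u @ [s]" t] st by auto
  moreover have "t \<notin> set (reflections u)"
  proof
    assume "t \<in> set (reflections u)"
    then obtain y where "y \<in> lists S" "length u = Suc (length y)" "t \<otimes> wp u = wp y"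
      using refl_delete[OF uS] by blast
    with \<open>red (t # u)\<close> show False unfolding red_def by force
  qed
  ultimately have "t = x \<otimes> s \<otimes> inv x"
    using uS u st by (simp add: refl_append S_carrier)
  then have "t \<otimes> x = x \<otimes> s \<otimes> inv x \<otimes> x" by simp
  then show ?thesis using x st by (simp add: S_carrier m_assoc)
qed

lemma left_eq_right:
  assumes x: "x \<in> carrier W" and st: "s \<in> S" "t \<in> S"
    and len: "len (x \<otimes> s) = len (t \<otimes> x)" "len (t \<otimes> x \<otimes> s) = len x"
  shows "t \<otimes> x = x \<otimes> s"
proof (cases "len x < len (t \<otimes> x)")
  case True
  then show ?thesis using left_eq_right_of_len_less[OF x st] len by simp
next
  case False
  \<comment> \<open>Passing from \<open>x\<close> to \<open>t x\<close> exchanges the roles of the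
    two lengths and reduces to the first case.\<close>
  then have "len (t \<otimes> x) < len (t \<otimes> (t \<otimes> x))" using len_left[OF x st(2)] x st by auto
  then have "t \<otimes> (t \<otimes> x) = t \<otimes> x \<otimes> s"
    using left_eq_right_of_len_less[of "t \<otimes> x" s t] x st len by (simp add: S_carrier)
  then have "x \<otimes> s = t \<otimes> x \<otimes> s \<otimes> s" using x st by simp
  then show ?thesis using x st by (simp add: S_carrier m_assoc)
qed


section \<open>The regular representation\<close>

text \<open>The operator on functions on \<open>W\<close> which is dual to multiplication by \<open>T\<^sub>s\<close>, where \<open>\<phi>\<close> is left or
  right multiplication by \<open>s\<close> and \<open>c = q s\<close>. Off the carrier it is the identity, so that
  the Hecke relations hold as equations between functions.\<close>

definition hecke_op :: "('w \<Rightarrow> 'w) \<Rightarrow> 'f::field \<Rightarrow> ('w \<Rightarrow> 'f) \<Rightarrow> 'w \<Rightarrow> 'f" where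
  "hecke_op \<phi> c f x = (if x \<notin> carrier W then f x
     else if len x < len (\<phi> x) then f (\<phi> x) else c * f (\<phi> x) + (1 - c) * f x)"

definition right_op :: "('w \<Rightarrow> 'f::field) \<Rightarrow> 'w \<Rightarrow> ('w \<Rightarrow> 'f) \<Rightarrow> 'w \<Rightarrow> 'f" where
  "right_op q s = hecke_op (\<lambda>x. x \<otimes> s) (q s)"

definition left_op :: "('w \<Rightarrow> 'f::field) \<Rightarrow> 'w \<Rightarrow> ('w \<Rightarrow> 'f) \<Rightarrow> 'w \<Rightarrow> 'f" where
  "left_op q t = hecke_op (\<lambda>x. t \<otimes> x) (q t)"

lemma right_op_quadratic:
  assumes "s \<in> S"
  shows "right_op q s (right_op q s f) x = (1 - q s) * right_op q s f x + q s * f x"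
proof (cases "x \<in> carrier W")
  case True
  then have "x \<otimes> s \<in> carrier W" "x \<otimes> s \<otimes> s = x" using assms by (auto simp: S_carrier m_assoc)
  then show ?thesis
    using len_right[OF True assms] True
    by (cases "len x < len (x \<otimes> s)") (simp_all add: right_op_def hecke_op_def)
next
  case False
  then show ?thesis by (simp add: right_op_def hecke_op_def algebra_simps)
qed

section \<open>Commutation of left and right operators\<close>

definition odd_constant :: "('w \<Rightarrow> 'b) \<Rightarrow> bool" where
  "odd_constant q \<longleftrightarrow>
    (\<forall>s \<in> S. \<forall>t \<in> S. s \<noteq> t \<and> (\<exists>k. m s t = enat k \<and> odd k) \<longrightarrow> q s = q t)"

text \<open>The parity of the number of letters with parameter \<open>q s\<close> is preserved by
  squares, by even braid relations, whose sides are permutations of each other, and by odd ones,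
  whose two letters have equal parameters. Comparing \<open>t # u\<close> with
  \<open>u @ [s]\<close> leaves the letters \<open>t\<close> and \<open>s\<close>.\<close>

lemma conjugate_parameters_eq:
  assumes q: "odd_constant q"
    and "x \<in> carrier W" "s \<in> S" "t \<in> S" "t \<otimes> x = x \<otimes> s"
  shows "q s = q t"
proof -
  define F where "F u = even (length (filter (\<lambda>r. q r = q s) u))" for u
  obtain u where u: "u \<in> lists S" "wp u = x" using assms(2) by (rule obtain_word)
  have alt: "length (filter P (alt_word k a b)) = length (filter P (alt_word k b a))"
    if "even k \<or> P a = P b" for P :: "'w \<Rightarrow> bool" and k a b
  proof (cases "even k")
    case True
    then have "alt_word k b a = rev (alt_word k a b)" by (simp add: rev_alt_word)
    then show ?thesis by (simp add: rev_filter[symmetric])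
  next
    case False
    with that have "map P (alt_word k a b) = map P (alt_word k b a)" by (simp add: map_alt_word)
    then have "length (filter id (map P (alt_word k a b))) = length (filter id (map P (alt_word k b a)))"
      by simp
    then show ?thesis by (simp add: filter_map)
  qed
  have "F (t # u) = F (u @ [s])"
  proof (rule word_invariant)
    show "braid_invariant F"
      unfolding braid_invariant_def
    proof (intro ballI allI impI, elim conjE)
      fix p r a b k assume "a \<in> S" "b \<in> S" "a \<noteq> b" "m a b = enat k"
      then have "even k \<or> (q a = q s) = (q b = q s)" using q by (auto simp: odd_constant_def)
      from alt[of k "\<lambda>r. q r = q s" a b, OF this]
      show "F (p @ alt_word k a b @ r) = F (p @ alt_word k b a @ r)"
        by (simp add: F_def)
    qed
  qed (use u assms in \<open>auto simp: F_def S_carrier\<close>)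
  then show ?thesis by (auto simp: F_def split: if_splits)
qed

text \<open>Here \<open>a\<close>, \<open>b\<close>, \<open>c\<close>, \<open>d\<close> are the
  lengths of \<open>x\<close>, \<open>x s\<close>, \<open>t x\<close>, \<open>t x s\<close>. Outside
  the excluded configuration, the two multiplications change the length independently of each
  other.\<close>

lemma four_lengths:
  fixes a b c d :: nat
  assumes "b = Suc a \<or> a = Suc b" "c = Suc a \<or> a = Suc c" "d = Suc c \<or> c = Suc d"
    "d = Suc b \<or> b = Suc d" "\<not> (b = c \<and> d = a)"
  shows "b = Suc a \<and> c = Suc a \<and> d = Suc (Suc a) \<or> b = Suc a \<and> a = Suc c \<and> d = a \<or>
    a = Suc b \<and> c = Suc a \<and> d = a \<or> a = Suc b \<and> a = Suc c \<and> a = Suc (Suc d)"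
  using assms by auto

lemma right_op_left_op_commute:
  assumes q: "odd_constant q"
    and st: "s \<in> S" "t \<in> S"
  shows "right_op q s (left_op q t f) = left_op q t (right_op q s f)"
proof
  fix x
  show "right_op q s (left_op q t f) x = left_op q t (right_op q s f) x"
  proof (cases "x \<in> carrier W")
    case False
    then show ?thesis by (simp add: right_op_def left_op_def hecke_op_def)
  next
    case x: True
    have c: "x \<otimes> s \<in> carrier W" "t \<otimes> x \<in> carrier W" "t \<otimes> (x \<otimes> s) = t \<otimes> x \<otimes> s"
      using x st by (auto simp: S_carrier m_assoc)
    note lens = len_right[OF x st(1)] len_left[OF x st(2)] len_right[OF c(2) st(1)]
      len_left[OF c(1) st(2), unfolded c(3)]
    show ?thesis
    proof (cases "t \<otimes> x = x \<otimes> s")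
      case True
      then have "q s = q t" using conjugate_parameters_eq[OF q x st] by simp
      with lens x c True show ?thesis
        by (auto simp: right_op_def left_op_def hecke_op_def algebra_simps)
    next
      case False
      \<comment> \<open>With this pattern excluded, each operator uses the same branch on both
        parallel sides of the square, so both composites expand alike.\<close>
      then have "\<not> (len (x \<otimes> s) = len (t \<otimes> x) \<and> len (t \<otimes> x \<otimes> s) = len x)"
        using left_eq_right[OF x st] by blast
      from four_lengths[OF lens this] show ?thesis
        by (elim disjE conjE; use x c in \<open>simp add: right_op_def left_op_def hecke_op_def algebra_simps\<close>)
    qed
  qed
qed

section \<open>Evaluation along reduced words\<close>

text \<open>While the length grows with every letter, only the shifting branch of
  \<open>hecke_op\<close> is used and no quadratic term appears.\<close>

lemma foldr_right_op:
  assumes "u \<in> lists S" "x \<in> carrier W" "len (x \<otimes> wp u) = len x + length u"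
  shows "foldr (right_op q) u f x = f (x \<otimes> wp u)"
  using assms
proof (induction u arbitrary: x)
  case (Cons s u)
  then have s: "s \<in> S" "u \<in> lists S" "x \<otimes> s \<in> carrier W" "x \<otimes> s \<otimes> wp u = x \<otimes> wp (s # u)"
    by (auto simp: S_carrier m_assoc)
  \<comment> \<open>If the first letter lowered the length, the remaining letters could not reach
    the assumed total.\<close>
  have "len (x \<otimes> wp (s # u)) \<le> len (x \<otimes> s) + length u"
    using len_mult_le[OF s(3) wp_closed[OF s(2)]] len_wp_le[OF s(2)] s(4) by simp
  then have "len (x \<otimes> s) = Suc (len x)"
    using len_right[of x s] s(1) Cons.prems by auto
  then show ?case using Cons s by (simp add: right_op_def hecke_op_def)
qed simp

text \<open>Here \<open>fold\<close> replaces \<open>foldr\<close>: the head letter must be the last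
  factor put on the left, so its operator is applied to \<open>f\<close> first.\<close>

lemma fold_left_op:
  assumes "u \<in> lists S" "x \<in> carrier W" "len (wp u \<otimes> x) = length u + len x"
  shows "fold (left_op q) u f x = f (wp u \<otimes> x)"
  using assms
proof (induction u arbitrary: f)
  case (Cons s u)
  then have s: "s \<in> S" "u \<in> lists S" by auto
  with assms(2) have s: "s \<in> S" "u \<in> lists S" "wp u \<otimes> x \<in> carrier W" "wp (s # u) \<otimes> x = s \<otimes> (wp u \<otimes> x)"
    by (auto simp: S_carrier m_assoc)
  have "len (wp u \<otimes> x) \<le> length u + len x"
    using len_mult_le[OF wp_closed[OF s(2)] assms(2)] len_wp_le[OF s(2)] by simp
  then have "len (wp u \<otimes> x) = length u + len x" "len (s \<otimes> (wp u \<otimes> x)) = Suc (len (wp u \<otimes> x))"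
    using len_left[OF s(3) s(1)] Cons.prems(2) s(4) by auto
  then show ?case using Cons s assms(2) by (simp add: left_op_def hecke_op_def)
qed simp

lemma len_one [simp]: "len \<one> = 0"
  using len_wp_le[of "[]"] by simp

lemma foldr_right_op_one: "red u \<Longrightarrow> foldr (right_op q) u f \<one> = f (wp u)"
  using foldr_right_op[of u \<one>] red_lists[of u] len_red[of u] by simp

lemma fold_left_op_one: "red u \<Longrightarrow> fold (left_op q) u f \<one> = f (wp u)"
  using fold_left_op[of u \<one>] red_lists[of u] len_red[of u] by simp

lemma foldr_right_op_off_carrier: "x \<notin> carrier W \<Longrightarrow> foldr (right_op q) u f x = f x"
  by (induction u) (auto simp: right_op_def hecke_op_def)

text \<open>A vector of the regular representation is determined by its left translates at \<open>\<one>\<close>, and the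
  right operators commute with the left ones; so it suffices to compare both sides at \<open>\<one>\<close>.\<close>

lemma right_op_braid:
  assumes q: "odd_constant q"
    and st: "s \<in> S" "t \<in> S" "s \<noteq> t" "m s t = enat k"
  shows "foldr (right_op q) (alt_word k s t) f = foldr (right_op q) (alt_word k t s) f"
proof
  fix x
  have comm1: "foldr (right_op q) u (left_op q t f) = left_op q t (foldr (right_op q) u f)"
    if "u \<in> lists S" "t \<in> S" for u t f
    using that right_op_left_op_commute[OF q] by (induction u) auto
  have comm: "foldr (right_op q) u (fold (left_op q) v f) = fold (left_op q) v (foldr (right_op q) u f)"
    if "u \<in> lists S" "v \<in> lists S" for u v f
    using that by (induction v arbitrary: f) (auto simp: comm1)
  show "foldr (right_op q) (alt_word k s t) f x = foldr (right_op q) (alt_word k t s) f x"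
  proof (cases "x \<in> carrier W")
    case True
    then obtain v where v: "red v" "wp v = x" by (metis obtain_red)
    have eq: "foldr (right_op q) u f x = fold (left_op q) v f (wp u)" if "red u" for u
      using comm[of u v f] that v red_lists foldr_right_op_one[OF that, of q "fold (left_op q) v f"]
        fold_left_op_one[OF v(1), of q "foldr (right_op q) u f"] by simp
    have "red (alt_word k s t)" "red (alt_word k t s)"
      using red_alt_word[of s t k] red_alt_word[of t s k] st m_sym[of s t] by auto
    then show ?thesis using eq wp_braid[OF st] by simp
  qed (simp add: foldr_right_op_off_carrier)
qed

end


section \<open>Modules over the free algebra\<close>

lemma sum_single_keys:
  fixes p :: "'a \<Rightarrow>\<^sub>0 'b::comm_monoid_add"
  shows "(\<Sum>u\<in>Poly_Mapping.keys p. Poly_Mapping.single u (Poly_Mapping.lookup p u)) = p"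
  by (rule poly_mapping_eqI)
    (auto simp: lookup_sum lookup_single when_def in_keys_iff sum.delta')

text \<open>Restricting the monomial case to the keys of \<open>p\<close> lets membership in the
  carrier of the free algebra pass to the words that occur.\<close>

lemma poly_mapping_single_induct:
  fixes p :: "'a \<Rightarrow>\<^sub>0 'b::comm_monoid_add"
  assumes "P 0" "\<And>u c. u \<in> Poly_Mapping.keys p \<Longrightarrow> P (Poly_Mapping.single u c)"
    and "\<And>r s. P r \<Longrightarrow> P s \<Longrightarrow> P (r + s)"
  shows "P p"
proof -
  have "P (\<Sum>u\<in>K. Poly_Mapping.single u (Poly_Mapping.lookup p u))"
    if "finite K" "K \<subseteq> Poly_Mapping.keys p" for K
    using that by induction (auto intro: assms)
  from this[of "Poly_Mapping.keys p"] show ?thesis by (simp add: sum_single_keys)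
qed

definition linear_op :: "(('i \<Rightarrow> 'f::field) \<Rightarrow> 'i \<Rightarrow> 'f) \<Rightarrow> bool" where
  "linear_op T \<longleftrightarrow> (\<forall>f g. T (\<lambda>x. f x + g x) = (\<lambda>x. T f x + T g x)) \<and>
    (\<forall>c f. T (\<lambda>x. c * f x) = (\<lambda>x. c * T f x))"

lemma linear_op_foldr: "(\<And>a. linear_op (L a)) \<Longrightarrow> linear_op (foldr L u)"
  by (induction u) (auto simp: linear_op_def)

text \<open>Substitution of the operator \<open>L a\<close> for the variable \<open>a\<close>; for
  linear operators this is a representation of the free algebra, by
  \<open>nc_act_mult\<close>.\<close>

definition nc_act ::
    "('a \<Rightarrow> ('i \<Rightarrow> 'f::field) \<Rightarrow> 'i \<Rightarrow> 'f) \<Rightarrow> ('a, 'f) nc_poly \<Rightarrow> ('i \<Rightarrow> 'f) \<Rightarrow> 'i \<Rightarrow> 'f" where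
  "nc_act L p f x = (\<Sum>u\<in>Poly_Mapping.keys p. Poly_Mapping.lookup p u * foldr L (letters u) f x)"

lemma nc_act_superset:
  assumes "finite K" "Poly_Mapping.keys p \<subseteq> K"
  shows "nc_act L p f x = (\<Sum>u\<in>K. Poly_Mapping.lookup p u * foldr L (letters u) f x)"
  unfolding nc_act_def using assms
  by (intro sum.mono_neutral_left) (auto simp: in_keys_iff)

lemma nc_act_zero [simp]: "nc_act L 0 f x = 0"
  by (simp add: nc_act_def)

lemma nc_act_single [simp]:
  "nc_act L (Poly_Mapping.single u c) f x = c * foldr L (letters u) f x"
  by (simp add: nc_act_def)

lemma nc_act_add: "nc_act L (p + r) f x = nc_act L p f x + nc_act L r f x"
proof -
  let ?K = "Poly_Mapping.keys p \<union> Poly_Mapping.keys r"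
  have "nc_act L s f x = (\<Sum>u\<in>?K. Poly_Mapping.lookup s u * foldr L (letters u) f x)"
    if "s \<in> {p, r, p + r}" for s
    using that keys_add[of p r] by (intro nc_act_superset) auto
  then show ?thesis by (simp add: lookup_add distrib_right sum.distrib)
qed

lemma nc_act_uminus: "nc_act L (- p) f x = - nc_act L p f x"
  using nc_act_add[of L p "- p" f x] by (simp add: eq_neg_iff_add_eq_0 add.commute)

lemma nc_act_diff: "nc_act L (p - r) f x = nc_act L p f x - nc_act L r f x"
  using nc_act_add[of L p "- r" f x] by (simp add: nc_act_uminus)

lemma nc_act_sum: "nc_act L (sum p J) f x = (\<Sum>i\<in>J. nc_act L (p i) f x)"
  by (induction J rule: infinite_finite_induct) (auto simp: nc_act_add)

lemma linear_op_nc_act: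
  assumes "\<And>a. linear_op (L a)"
  shows "linear_op (nc_act L p)"
  using linear_op_foldr[of L, OF assms]
  by (simp add: linear_op_def nc_act_def fun_eq_iff distrib_left sum.distrib sum_distrib_left
      mult.left_commute)

lemma nc_act_mult:
  assumes lin: "\<And>a. linear_op (L a)"
  shows "nc_act L (p * r) f = nc_act L p (nc_act L r f)"
proof (induction p rule: poly_mapping_single_induct)
  case 1
  show ?case by (simp add: fun_eq_iff)
next
  case (2 u c)
  show ?case
  proof (induction r rule: poly_mapping_single_induct)
    case 1
    \<comment> \<open>Writing zero as \<open>0 * 0\<close> makes it an instance of the scaling law
      of \<open>linear_op\<close>.\<close>
    have "foldr L (letters u) (\<lambda>x. 0 * 0) = (\<lambda>x. 0 * foldr L (letters u) (\<lambda>x. 0) x)"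
      using linear_op_foldr[of L, OF lin] by (simp only: linear_op_def)
    then show ?case by (simp add: fun_eq_iff)
  next
    case (2 v d)
    have "nc_act L (Poly_Mapping.single v d) f = (\<lambda>x. d * foldr L (letters v) f x)"
      by (simp add: fun_eq_iff)
    moreover have "foldr L (letters u) (\<lambda>x. d * foldr L (letters v) f x)
        = (\<lambda>x. d * foldr L (letters u) (foldr L (letters v) f) x)"
      using linear_op_foldr[of L, OF lin] by (simp add: linear_op_def)
    ultimately show ?case
      by (simp add: fun_eq_iff mult_single plus_free_monoid_def mult.assoc)
  next
    case (3 r s)
    have "nc_act L (r + s) f = (\<lambda>x. nc_act L r f x + nc_act L s f x)"
      by (simp add: fun_eq_iff nc_act_add)
    then show ?case
      using 3 linear_op_nc_act[of L, OF lin, where p = "Poly_Mapping.single u c"]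
      by (simp add: linear_op_def fun_eq_iff distrib_left nc_act_add del: nc_act_single)
  qed
next
  case (3 p s)
  then show ?case by (simp add: fun_eq_iff distrib_right nc_act_add)
qed


section \<open>The free algebra and its ideals\<close>

definition mon :: "'a list \<Rightarrow> ('a, 'f::field) nc_poly" where
  "mon u = Poly_Mapping.single (Word u) 1"

lemma mon_Nil: "mon [] = 1"
  by (simp add: mon_def zero_free_monoid_def[symmetric])

lemma mon_mult: "mon u * mon v = mon (u @ v)"
  by (simp add: mon_def mult_single plus_free_monoid_def)

lemma nc_var_eq_mon: "nc_var s = mon [s]"
  by (simp add: nc_var_def mon_def)

lemma prod_list_nc_var: "prod_list (map nc_var u) = mon u"
  by (induction u) (simp_all add: mon_Nil nc_var_eq_mon mon_mult)

lemma nc_const_mult_mon: "nc_const c * mon u = Poly_Mapping.single (Word u) c"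
  by (simp add: mon_def nc_const_def mult_single)

lemma nc_const_commute: "p * nc_const c = nc_const c * p" for p :: "('a, 'f::field) nc_poly"
  by (induction p rule: poly_mapping_single_induct)
    (simp_all add: nc_const_def mult_single mult.commute distrib_left distrib_right)

lemma nc_const_0 [simp]: "nc_const 0 = 0" and nc_const_1 [simp]: "nc_const 1 = 1"
  and nc_const_add: "nc_const (c + d) = nc_const c + nc_const d"
  and nc_const_diff: "nc_const (c - d) = nc_const c - nc_const d"
  and nc_const_mult: "nc_const (c * d) = nc_const c * nc_const d"
  by (simp_all add: nc_const_def single_add single_diff mult_single)

lemma free_algebra_simps [simp]:
  "monoid.mult (free_algebra X) = (*)" "one (free_algebra X) = 1"
  "ring.zero (free_algebra X) = 0" "add (free_algebra X) = (+)"
  by (simp_all add: free_algebra_def)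

definition free_carrier :: "'a set \<Rightarrow> ('a, 'f::field) nc_poly set" where
  "free_carrier X = {p. \<forall>u \<in> Poly_Mapping.keys p. letters u \<in> lists X}"

lemma carrier_free_algebra [simp]: "carrier (free_algebra X) = free_carrier X"
  by (simp add: free_algebra_def free_carrier_def)

lemma free_carrier_add: "p \<in> free_carrier X \<Longrightarrow> r \<in> free_carrier X \<Longrightarrow> p + r \<in> free_carrier X"
  using keys_add[of p r] by (auto simp: free_carrier_def)

lemma free_carrier_uminus: "p \<in> free_carrier X \<Longrightarrow> - p \<in> free_carrier X"
  by (auto simp: free_carrier_def in_keys_iff)

lemma free_carrier_diff: "p \<in> free_carrier X \<Longrightarrow> r \<in> free_carrier X \<Longrightarrow> p - r \<in> free_carrier X"
  using free_carrier_add[OF _ free_carrier_uminus, of p X r] by simp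

lemma free_carrier_mult: "p \<in> free_carrier X \<Longrightarrow> r \<in> free_carrier X \<Longrightarrow> p * r \<in> free_carrier X"
  using keys_mult[of p r] by (fastforce simp: free_carrier_def plus_free_monoid_def)

lemma free_carrier_const: "nc_const c \<in> free_carrier X"
  by (auto simp: free_carrier_def nc_const_def zero_free_monoid_def)

lemma free_carrier_zero: "0 \<in> free_carrier X" and free_carrier_one: "1 \<in> free_carrier X"
  using free_carrier_const[of 0] free_carrier_const[of 1] by simp_all

lemma free_carrier_mon: "u \<in> lists X \<Longrightarrow> mon u \<in> free_carrier X"
  by (auto simp: free_carrier_def mon_def)

lemmas free_carrier_intros = free_carrier_add free_carrier_diff free_carrier_mult
  free_carrier_const free_carrier_zero free_carrier_one free_carrier_mon

lemma free_carrier_sum: "(\<And>i. i \<in> J \<Longrightarrow> p i \<in> free_carrier X) \<Longrightarrow> sum p J \<in> free_carrier X"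
  by (induction J rule: infinite_finite_induct) (auto intro: free_carrier_intros)

lemma ring_free_algebra: "ring (free_algebra X :: ('a, 'f::field) nc_poly ring)"
proof (rule ringI)
  show "abelian_group (free_algebra X :: ('a, 'f) nc_poly ring)"
  proof (rule abelian_groupI)
    fix p :: "('a, 'f) nc_poly"
    assume "p \<in> carrier (free_algebra X)"
    then show "\<exists>r \<in> carrier (free_algebra X). r \<oplus>\<^bsub>free_algebra X\<^esub> p = \<zero>\<^bsub>free_algebra X\<^esub>"
      by (intro bexI[of _ "- p"]) (auto intro: free_carrier_uminus)
  qed (auto intro: free_carrier_intros simp: add.assoc add.commute)
  show "monoid (free_algebra X :: ('a, 'f) nc_poly ring)"
    by (rule monoidI) (auto intro: free_carrier_intros simp: mult.assoc)
qed (auto simp: distrib_left distrib_right)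

lemma a_inv_free_algebra:
  assumes "p \<in> free_carrier X"
  shows "\<ominus>\<^bsub>free_algebra X\<^esub> p = - (p :: ('a, 'f::field) nc_poly)"
proof -
  interpret ring "free_algebra X :: ('a, 'f) nc_poly ring" by (rule ring_free_algebra)
  show ?thesis using minus_equality[of "- p" p] assms by (simp add: free_carrier_uminus)
qed

lemma free_algebra_idealI:
  fixes K :: "('a, 'f::field) nc_poly set"
  assumes "K \<subseteq> free_carrier X" "0 \<in> K" "\<And>p r. p \<in> K \<Longrightarrow> r \<in> K \<Longrightarrow> p + r \<in> K"
    and "\<And>p. p \<in> K \<Longrightarrow> - p \<in> K"
    and "\<And>p r. p \<in> K \<Longrightarrow> r \<in> free_carrier X \<Longrightarrow> r * p \<in> K"
    and "\<And>p r. p \<in> K \<Longrightarrow> r \<in> free_carrier X \<Longrightarrow> p * r \<in> K"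
  shows "ideal K (free_algebra X)"
proof (rule idealI[OF ring_free_algebra])
  interpret ring "free_algebra X :: ('a, 'f) nc_poly ring" by (rule ring_free_algebra)
  show "subgroup K (add_monoid (free_algebra X))"
  proof (rule add.subgroupI)
    fix p assume "p \<in> K"
    then show "\<ominus>\<^bsub>free_algebra X\<^esub> p \<in> K"
      using assms(1,4) a_inv_free_algebra[of p X] by auto
  qed (use assms in auto)
qed (use assms in auto)


section \<open>The Hecke algebra\<close>

locale hecke = coxeter W S m for W :: "'w monoid" (structure) and S m +
  fixes q :: "'w \<Rightarrow> 'f::field"
begin

abbreviation A :: "('w, 'f) nc_poly ring" where "A \<equiv> free_algebra S"
abbreviation I :: "('w, 'f) nc_poly set" where "I \<equiv> hecke_ideal S m q"
abbreviation H :: "('f, ('w, 'f) nc_poly set) module" where "H \<equiv> hecke_algebra S m q"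
abbreviation FA :: "('w, 'f) nc_poly set" where "FA \<equiv> free_carrier S"
abbreviation cls :: "('w, 'f) nc_poly \<Rightarrow> ('w, 'f) nc_poly set" where "cls p \<equiv> I +>\<^bsub>A\<^esub> p"

lemma relators_subset: "hecke_relators S m q \<subseteq> FA"
  unfolding hecke_relators_def
  by (auto simp: prod_list_nc_var) (auto simp: nc_var_eq_mon intro!: free_carrier_intros)

sublocale ideal I A
  unfolding hecke_ideal_def
  using relators_subset by (intro ring.genideal_ideal[OF ring_free_algebra]) simp

lemma relators_in_I: "hecke_relators S m q \<subseteq> I"
  unfolding hecke_ideal_def
  using relators_subset by (intro ring.genideal_self[OF ring_free_algebra]) simp

lemma cls_eq_iff:
  assumes "p \<in> FA" "r \<in> FA"
  shows "cls p = cls r \<longleftrightarrow> p - r \<in> I"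
  using quotient_eq_iff_same_a_r_cos[OF is_ideal, of p r] assms
  by (simp add: a_minus_def a_inv_free_algebra)

lemma cls_add_eq: "p \<in> FA \<Longrightarrow> p' \<in> FA \<Longrightarrow> r \<in> FA \<Longrightarrow> r' \<in> FA \<Longrightarrow> cls p = cls p' \<Longrightarrow> cls r = cls r' \<Longrightarrow>
    cls (p + r) = cls (p' + r')"
  using a_rcos_sum[of p r] a_rcos_sum[of p' r'] by simp

lemma cls_mult_eq: "p \<in> FA \<Longrightarrow> p' \<in> FA \<Longrightarrow> r \<in> FA \<Longrightarrow> r' \<in> FA \<Longrightarrow> cls p = cls p' \<Longrightarrow> cls r = cls r' \<Longrightarrow>
    cls (p * r) = cls (p' * r')"
  using rcoset_mult_add[of p r] rcoset_mult_add[of p' r'] by simp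

lemma hecke_simps:
  "carrier H = cls ` FA" "one H = cls 1" "\<zero>\<^bsub>H\<^esub> = cls 0"
  "p \<in> FA \<Longrightarrow> r \<in> FA \<Longrightarrow> cls p \<otimes>\<^bsub>H\<^esub> cls r = cls (p * r)"
  "p \<in> FA \<Longrightarrow> r \<in> FA \<Longrightarrow> cls p \<oplus>\<^bsub>H\<^esub> cls r = cls (p + r)"
  "p \<in> FA \<Longrightarrow> c \<odot>\<^bsub>H\<^esub> cls p = cls (nc_const c * p)"
  using rcoset_mult_add[of p r] rcoset_mult_add[of "nc_const c" p] a_rcos_sum[of p r] a_rcos_zero[OF is_ideal, of 0]
    zero_closed
  by (auto simp: hecke_algebra_def Let_def FactRing_def A_RCOSETS_def' a_r_coset_def' free_carrier_const)

lemma abelian_monoid_H: "abelian_monoid H"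
proof -
  interpret Q: ring "A Quot I" by (rule quotient_is_ring)
  have eq: "carrier H = carrier (A Quot I)" "add H = add (A Quot I)" "\<zero>\<^bsub>H\<^esub> = \<zero>\<^bsub>A Quot I\<^esub>"
    by (simp_all add: hecke_algebra_def Let_def)
  show ?thesis
    by (rule abelian_monoidI) (simp_all add: eq Q.a_ac)
qed

lemma finsum_cls:
  assumes "finite J" "\<And>i. i \<in> J \<Longrightarrow> p i \<in> FA"
  shows "(\<Oplus>\<^bsub>H\<^esub>i\<in>J. cls (p i)) = cls (sum p J)"
proof -
  interpret H: abelian_monoid H by (rule abelian_monoid_H)
  show ?thesis
    using assms by (induction J) (auto simp: hecke_simps free_carrier_sum)
qed

lemma word_prod_hecke_gen:
  "u \<in> lists S \<Longrightarrow> word_prod H (map (hecke_gen S m q) u) = cls (mon u)"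
proof (induction u)
  case Nil
  show ?case by (simp add: word_prod_def hecke_simps mon_Nil)
next
  case (Cons s u)
  then show ?case
    by (simp add: word_prod_def hecke_gen_def nc_var_eq_mon hecke_simps free_carrier_mon mon_mult)
qed

lemma cls_quadratic:
  assumes "s \<in> S"
  shows "cls (mon [s, s]) = cls (nc_const (1 - q s) * mon [s] + nc_const (q s))"
proof -
  have "(nc_var s - 1) * (nc_var s + nc_const (q s)) \<in> I"
    using relators_in_I assms by (auto simp: hecke_relators_def)
  also have "(nc_var s - 1) * (nc_var s + nc_const (q s))
      = mon [s, s] - (nc_const (1 - q s) * mon [s] + nc_const (q s))"
    by (simp add: nc_var_eq_mon algebra_simps mon_mult nc_const_diff nc_const_commute)
  finally show ?thesis
    using assms by (subst cls_eq_iff) (auto intro!: free_carrier_intros)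
qed

lemma cls_quadratic_context:
  assumes "p \<in> lists S" "r \<in> lists S" "s \<in> S"
  shows "cls (mon (p @ [s, s] @ r))
    = cls (nc_const (1 - q s) * mon (p @ [s] @ r) + nc_const (q s) * mon (p @ r))"
proof -
  have "cls (mon (p @ [s, s] @ r)) = cls (mon p * mon [s, s] * mon r)"
    by (simp add: mon_mult)
  also have "\<dots> = cls (mon p * (nc_const (1 - q s) * mon [s] + nc_const (q s)) * mon r)"
    using assms by (intro cls_mult_eq cls_quadratic) (auto intro!: free_carrier_intros)
  also have "mon p * (nc_const (1 - q s) * mon [s] + nc_const (q s)) * mon r
      = (mon p * nc_const (1 - q s)) * mon [s] * mon r + (mon p * nc_const (q s)) * mon r"
    by (simp add: algebra_simps)
  also have "\<dots> = nc_const (1 - q s) * mon (p @ [s] @ r) + nc_const (q s) * mon (p @ r)"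
    unfolding nc_const_commute by (simp add: mult.assoc mon_mult)
  finally show ?thesis .
qed

lemma braid_invariant_cls_mon: "braid_invariant (\<lambda>u. cls (mon u))"
  unfolding braid_invariant_def
proof (intro ballI allI impI, elim conjE)
  fix p r s t k
  assume *: "p \<in> lists S" "r \<in> lists S" "s \<in> S" "t \<in> S" "s \<noteq> t" "m s t = enat k"
  then have "prod_list (map nc_var (alt_word k s t)) - prod_list (map nc_var (alt_word k t s)) \<in> I"
    using relators_in_I unfolding hecke_relators_def by blast
  then have "cls (mon (alt_word k s t)) = cls (mon (alt_word k t s))"
    using * by (subst cls_eq_iff) (auto simp: prod_list_nc_var intro: free_carrier_mon)
  then have "cls (mon p * mon (alt_word k s t) * mon r) = cls (mon p * mon (alt_word k t s) * mon r)"
    using * by (intro cls_mult_eq) (auto intro!: free_carrier_intros)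
  then show "cls (mon (p @ alt_word k s t @ r)) = cls (mon (p @ alt_word k t s @ r))"
    by (simp add: mon_mult)
qed

definition rexp :: "'w \<Rightarrow> 'w list" where
  "rexp x = (SOME u. reduced_expression W S x u)"

lemma rexp:
  assumes "x \<in> carrier W"
  shows "red (rexp x)" "wp (rexp x) = x" "rexp x \<in> lists S"
proof -
  obtain u where "red u" "wp u = x" using assms by (rule obtain_red)
  then have "reduced_expression W S x (rexp x)"
    unfolding rexp_def by (metis someI_ex reduced_expression_iff)
  then show "red (rexp x)" "wp (rexp x) = x" by (simp_all add: reduced_expression_iff)
  then show "rexp x \<in> lists S" by (simp add: red_lists)
qed

lemma hecke_T_eq: "x \<in> carrier W \<Longrightarrow> hecke_T W S m q x = cls (mon (rexp x))"
  using word_prod_hecke_gen[OF rexp(3)] by (simp add: hecke_T_def rexp_def)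

text \<open>Here Matsumoto's theorem makes \<open>T_w\<close> independent of the expression picked
  by \<open>SOME\<close>.\<close>

lemma cls_mon_rexp: "red u \<Longrightarrow> cls (mon (rexp (wp u))) = cls (mon u)"
  by (rule matsumoto[OF braid_invariant_cls_mon]) (auto simp: rexp red_lists)

lemma hecke_T_carrier: "hecke_T W S m q \<in> carrier W \<rightarrow> carrier H"
  by (auto simp: hecke_T_eq hecke_simps rexp intro!: imageI free_carrier_mon)

text \<open>A lift to the free algebra of a linear combination of the \<open>T_x\<close>, so that
  computations take place among polynomials before passing to classes.\<close>

definition comb :: "'w set \<Rightarrow> ('w \<Rightarrow> 'f) \<Rightarrow> ('w, 'f) nc_poly" where
  "comb J c = (\<Sum>x\<in>J. nc_const (c x) * mon (rexp x))"

lemma comb_FA: "J \<subseteq> carrier W \<Longrightarrow> comb J c \<in> FA"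
  unfolding comb_def using rexp by (intro free_carrier_sum free_carrier_intros) auto

lemma finsum_hecke_T:
  assumes "finite J" "J \<subseteq> carrier W"
  shows "(\<Oplus>\<^bsub>H\<^esub>x\<in>J. c x \<odot>\<^bsub>H\<^esub> hecke_T W S m q x) = cls (comb J c)"
proof -
  interpret H: abelian_monoid H by (rule abelian_monoid_H)
  have FA: "nc_const (c x) * mon (rexp x) \<in> FA" if "x \<in> J" for x
    using that assms rexp by (auto intro!: free_carrier_intros)
  have "(\<Oplus>\<^bsub>H\<^esub>x\<in>J. c x \<odot>\<^bsub>H\<^esub> hecke_T W S m q x) = (\<Oplus>\<^bsub>H\<^esub>x\<in>J. cls (nc_const (c x) * mon (rexp x)))"
    using assms FA rexp by (intro H.finsum_cong') (auto simp: hecke_T_eq hecke_simps free_carrier_mon)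
  also have "\<dots> = cls (comb J c)"
    unfolding comb_def using assms FA by (intro finsum_cls) auto
  finally show ?thesis .
qed


section \<open>Spanning\<close>

definition spanned :: "('w, 'f) nc_poly \<Rightarrow> bool" where
  "spanned p \<longleftrightarrow> p \<in> FA \<and> (\<exists>J c. finite J \<and> J \<subseteq> carrier W \<and> cls p = cls (comb J c))"

lemma spanned_cong: "spanned p \<Longrightarrow> r \<in> FA \<Longrightarrow> cls r = cls p \<Longrightarrow> spanned r"
  by (auto simp: spanned_def)

lemma spanned_add:
  assumes "spanned p" "spanned r"
  shows "spanned (p + r)"
proof -
  obtain J c where J: "finite J" "J \<subseteq> carrier W" "p \<in> FA" "cls p = cls (comb J c)"
    using assms by (auto simp: spanned_def)
  obtain K d where K: "finite K" "K \<subseteq> carrier W" "r \<in> FA" "cls r = cls (comb K d)"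
    using assms by (auto simp: spanned_def)
  \<comment> \<open>Coefficients extended by zero to the common index set
    \<open>J \<union> K\<close>.\<close>
  define e f where "e x = (if x \<in> J then c x else 0)" and "f x = (if x \<in> K then d x else 0)" for x
  have "comb J c = comb (J \<union> K) e" "comb K d = comb (J \<union> K) f"
    unfolding comb_def e_def f_def using J K by (auto intro!: sum.mono_neutral_cong_left)
  then have "comb J c + comb K d = comb (J \<union> K) (\<lambda>x. e x + f x)"
    by (simp add: comb_def sum.distrib nc_const_add distrib_right)
  moreover have "cls (p + r) = cls (comb J c + comb K d)"
    using J K by (intro cls_add_eq comb_FA) auto
  ultimately show ?thesis
    unfolding spanned_def using J K
    by (auto intro!: free_carrier_intros exI[of _ "J \<union> K"])
qed

lemma spanned_zero: "spanned 0"
  unfolding spanned_def comb_def by (auto intro!: free_carrier_zero exI[of _ "{}"])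

lemma spanned_sum: "(\<And>i. i \<in> J \<Longrightarrow> spanned (p i)) \<Longrightarrow> spanned (sum p J)"
  by (induction J rule: infinite_finite_induct) (auto intro: spanned_add spanned_zero)

lemma spanned_const_mult:
  assumes "spanned p"
  shows "spanned (nc_const k * p)"
proof -
  obtain J c where J: "finite J" "J \<subseteq> carrier W" "p \<in> FA" "cls p = cls (comb J c)"
    using assms by (auto simp: spanned_def)
  have "cls (nc_const k * p) = cls (nc_const k * comb J c)"
    using J by (intro cls_mult_eq comb_FA free_carrier_const) auto
  also have "nc_const k * comb J c = comb J (\<lambda>x. k * c x)"
    by (simp add: comb_def sum_distrib_left nc_const_mult mult.assoc)
  finally show ?thesis
    unfolding spanned_def using J by (auto intro!: free_carrier_intros)
qed

lemma spanned_red: "red u \<Longrightarrow> spanned (mon u)"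
  unfolding spanned_def using red_lists[of u]
  by (auto intro!: free_carrier_intros exI[of _ "{wp u}"] exI[of _ "\<lambda>_. 1"]
      simp: comb_def cls_mon_rexp)

text \<open>If \<open>s # u\<close> is not reduced, the class of \<open>u\<close> is that of a
  reduced word \<open>s # v\<close>, and the quadratic relation rewrites \<open>s s v\<close>
  through the reduced words \<open>s # v\<close> and \<open>v\<close>.\<close>

lemma spanned_Cons_red:
  assumes "red u" "s \<in> S"
  shows "spanned (mon (s # u))"
proof (cases "red (s # u)")
  case True
  then show ?thesis by (rule spanned_red)
next
  case False
  have u: "u \<in> lists S" using assms red_lists by blast
  then have lens: "len (s \<otimes> wp u) \<noteq> Suc (len (wp u))"
    using False assms by (simp add: red_iff_len)
  obtain v where v: "red v" "wp v = s \<otimes> wp u" "length v = len (s \<otimes> wp u)"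
    using obtain_red[of "s \<otimes> wp u"] u assms by (auto simp: S_carrier)
  then have vS: "v \<in> lists S" by (simp add: red_lists)
  have wp: "wp (s # v) = wp u" using v u assms by simp
  then have sv: "red (s # v)"
    using len_left[of "wp u" s] lens u assms v vS by (simp add: red_iff_len)
  have "cls (mon u) = cls (mon (s # v))"
    using cls_mon_rexp[OF sv] cls_mon_rexp[OF assms(1)] wp by simp
  then have "cls (mon [s] * mon u) = cls (mon [s] * mon (s # v))"
    using u vS assms by (intro cls_mult_eq) (auto intro!: free_carrier_intros)
  also have "mon [s] * mon (s # v) = mon ([] @ [s, s] @ v)" by (simp add: mon_mult)
  also have "cls \<dots> = cls (nc_const (1 - q s) * mon ([] @ [s] @ v) + nc_const (q s) * mon ([] @ v))"
    using vS assms by (intro cls_quadratic_context) auto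
  finally have "cls (mon (s # u)) = cls (nc_const (1 - q s) * mon (s # v) + nc_const (q s) * mon v)"
    by (simp add: mon_mult)
  moreover have "spanned (nc_const (1 - q s) * mon (s # v) + nc_const (q s) * mon v)"
    using sv v by (intro spanned_add spanned_const_mult spanned_red)
  ultimately show ?thesis
    using u assms by (elim spanned_cong[rotated 2]) (auto intro: free_carrier_mon)
qed

lemma spanned_var_mult:
  assumes "spanned p" "s \<in> S"
  shows "spanned (mon [s] * p)"
proof -
  obtain J c where J: "finite J" "J \<subseteq> carrier W" "p \<in> FA" "cls p = cls (comb J c)"
    using assms by (auto simp: spanned_def)
  have "cls (mon [s] * p) = cls (mon [s] * comb J c)"
    using J assms by (intro cls_mult_eq comb_FA free_carrier_mon) auto
  moreover have "mon [s] * comb J c = (\<Sum>x\<in>J. nc_const (c x) * mon (s # rexp x))"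
    unfolding comb_def sum_distrib_left mult.assoc[symmetric] nc_const_commute
    by (simp add: mult.assoc mon_mult)
  moreover have "spanned (\<Sum>x\<in>J. nc_const (c x) * mon (s # rexp x))"
    using J assms rexp by (intro spanned_sum spanned_const_mult spanned_Cons_red) auto
  ultimately show ?thesis
    using J assms by (elim spanned_cong) (auto intro!: free_carrier_intros)
qed

lemma spanned_mon: "u \<in> lists S \<Longrightarrow> spanned (mon u)"
proof (induction u)
  case Nil
  show ?case by (rule spanned_red) (simp add: red_def)
next
  case (Cons s u)
  then show ?case using spanned_var_mult[of "mon u" s] by (simp add: mon_mult)
qed

lemma spanned_FA:
  assumes "p \<in> FA"
  shows "spanned p"
proof (rule poly_mapping_single_induct)
  fix u c assume "u \<in> Poly_Mapping.keys p"
  then have "letters u \<in> lists S" using assms by (auto simp: free_carrier_def)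
  then have "spanned (nc_const c * mon (letters u))"
    by (intro spanned_const_mult spanned_mon)
  then show "spanned (Poly_Mapping.single u c)" by (simp add: nc_const_mult_mon)
qed (auto intro: spanned_add spanned_zero)

theorem spanning: "spanning_family H (carrier W) (hecke_T W S m q)"
  unfolding spanning_family_def
proof (intro conjI hecke_T_carrier ballI)
  fix x assume "x \<in> carrier H"
  then obtain p where p: "p \<in> FA" "x = cls p" by (auto simp: hecke_simps)
  with spanned_FA[OF p(1)] obtain J c where J: "finite J" "J \<subseteq> carrier W" "cls p = cls (comb J c)"
    unfolding spanned_def by (elim conjE exE)
  then have "x = (\<Oplus>\<^bsub>H\<^esub>i\<in>J. c i \<odot>\<^bsub>H\<^esub> hecke_T W S m q i)"
    using p(2) finsum_hecke_T[of J c] by simp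
  with J show "\<exists>J c. finite J \<and> J \<subseteq> carrier W \<and> x = (\<Oplus>\<^bsub>H\<^esub>i\<in>J. c i \<odot>\<^bsub>H\<^esub> hecke_T W S m q i)"
    by (intro exI conjI)
qed


section \<open>Independence\<close>

lemma linear_op_right_op: "linear_op (right_op q s)"
  by (auto simp: linear_op_def right_op_def hecke_op_def fun_eq_iff algebra_simps)

text \<open>The polynomials acting as zero form a two-sided ideal, so only the relators need to be
  checked.\<close>

lemma nc_act_ideal:
  assumes "odd_constant q" "p \<in> I"
  shows "nc_act (right_op q) p f x = 0"
proof -
  let ?K = "{p \<in> FA. \<forall>f x. nc_act (right_op q) p f x = 0}"
  have "ideal ?K A"
  proof (rule free_algebra_idealI)
    fix p r assume *: "p \<in> ?K" "r \<in> FA"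
    then have "nc_act (right_op q) p f = (\<lambda>x. 0)" for f by (simp add: fun_eq_iff)
    moreover have "nc_act (right_op q) r (\<lambda>x. 0) = (\<lambda>x. 0)"
    proof -
      have "nc_act (right_op q) r (\<lambda>x. 0 * 0) = (\<lambda>x. 0 * nc_act (right_op q) r (\<lambda>x. 0) x)"
        using linear_op_nc_act[of "right_op q", OF linear_op_right_op, where p = r] by (simp only: linear_op_def)
      then show ?thesis by simp
    qed
    ultimately show "r * p \<in> ?K" "p * r \<in> ?K"
      using * by (auto simp: nc_act_mult linear_op_right_op intro: free_carrier_intros)
  qed (auto simp: nc_act_add nc_act_uminus intro: free_carrier_intros free_carrier_uminus)
  moreover have "hecke_relators S m q \<subseteq> ?K"
  proof
    fix p assume p: "p \<in> hecke_relators S m q"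
    then have "p \<in> FA" using relators_subset by blast
    moreover have "nc_act (right_op q) p f x = 0" for f x
    proof -
      from p consider s where "s \<in> S" "p = (nc_var s - 1) * (nc_var s + nc_const (q s))"
        | s t k where "s \<in> S" "t \<in> S" "s \<noteq> t" "m s t = enat k"
            "p = prod_list (map nc_var (alt_word k s t)) - prod_list (map nc_var (alt_word k t s))"
        by (auto simp: hecke_relators_def)
      then show ?thesis
      proof cases
        case 1
        have "p = mon [s, s] - (nc_const (1 - q s) * mon [s] + nc_const (q s) * mon [])"
          unfolding 1(2)
          by (simp add: nc_var_eq_mon algebra_simps mon_mult nc_const_diff nc_const_commute mon_Nil)
        then show ?thesis
          using right_op_quadratic[OF 1(1), of q f x]
          by (simp add: nc_act_diff nc_act_add nc_const_mult_mon) (simp add: mon_def)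
      next
        case 2
        then show ?thesis
          using right_op_braid[OF assms(1) 2(1-4), of f]
          by (simp add: prod_list_nc_var nc_act_diff) (simp add: mon_def)
      qed
    qed
    ultimately show "p \<in> ?K" by simp
  qed
  ultimately have "I \<subseteq> ?K"
    unfolding hecke_ideal_def by (intro ring.genideal_minimal[OF ring_free_algebra])
  with assms show ?thesis by blast
qed

theorem independent:
  assumes "odd_constant q"
  shows "independent_family H (carrier W) (hecke_T W S m q)"
  unfolding independent_family_def
proof (intro conjI hecke_T_carrier allI impI ballI, elim conjE)
  fix J c y
  assume J: "finite J" "J \<subseteq> carrier W" "y \<in> J"
    and "(\<Oplus>\<^bsub>H\<^esub>i\<in>J. c i \<odot>\<^bsub>H\<^esub> hecke_T W S m q i) = \<zero>\<^bsub>H\<^esub>"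
  then have "cls (comb J c) = cls 0" by (simp add: finsum_hecke_T hecke_simps)
  then have "comb J c \<in> I"
    using comb_FA[OF J(2), of c] by (simp add: cls_eq_iff free_carrier_zero)
  \<comment> \<open>By \<open>foldr_right_op_one\<close>, a reduced word sends a function to an
    operator image whose value at the identity is the function at its product; the indicator of
    \<open>y\<close> thus isolates \<open>c y\<close>.\<close>
  then have "nc_act (right_op q) (comb J c) (\<lambda>x. if x = y then 1 else 0) \<one> = 0"
    using nc_act_ideal[OF assms] by blast
  also have "nc_act (right_op q) (comb J c) (\<lambda>x. if x = y then 1 else 0) \<one>
      = (\<Sum>x\<in>J. c x * (if x = y then 1 else 0))"
    unfolding comb_def nc_act_sum
    using J(2) rexp by (intro sum.cong) (auto simp: nc_const_mult_mon foldr_right_op_one)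
  also have "\<dots> = c y" using J by (simp add: sum.delta' if_distrib cong: if_cong)
  finally show "c y = 0" .
qed

section \<open>Necessity of the condition on the parameters\<close>

theorem independent_odd_constant:
  assumes "independent_family H (carrier W) (hecke_T W S m q)"
  shows "odd_constant q"
  unfolding odd_constant_def
proof (intro ballI impI, elim conjE exE)
  fix s t k
  assume st: "s \<in> S" "t \<in> S" "s \<noteq> t" "m s t = enat k" "odd k"
  then obtain n where k: "k = Suc n" "even n" by (cases k) auto
  let ?a = "alt_word k s t" and ?a' = "alt_word k t s" and ?b = "alt_word n t s"
  \<comment> \<open>Oddness of \<open>k\<close> enters here: as \<open>n\<close> is even,
    \<open>?a'\<close> ends in \<open>t\<close>, so \<open>?b\<close> lies in both sides of the
    braid relation.\<close>
  have a: "?a = s # ?b" and a': "?a' = ?b @ [t]"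
    using alt_word_Suc_right[of n t s] k by simp_all
  have lists: "?a \<in> lists S" "?a' \<in> lists S" "?b \<in> lists S" using st by simp_all
  have braid: "cls (mon (p @ ?a @ r)) = cls (mon (p @ ?a' @ r))" if "p \<in> lists S" "r \<in> lists S" for p r
    using braid_invariant_cls_mon[unfolded braid_invariant_def, rule_format, of p r s t k] that st by simp
  have red: "red ?a" "red ?b"
    using red_alt_word[of s t k] red_alt_word[of t s n] st m_sym[of s t] k by simp_all
  have neq: "wp ?a \<noteq> wp ?b"
    using length_parity_wp_eq[OF lists(1,3)] k by auto
  have "cls (nc_const (1 - q s) * mon ?a + nc_const (q s) * mon ?b) = cls (mon ([s] @ ?a @ []))"
    using cls_quadratic_context[of "[]" ?b s] st unfolding a by simp
  also have "\<dots> = cls (mon ([s] @ ?a' @ []))"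
    by (rule braid) (use st in auto)
  \<comment> \<open>Both spell \<open>s b t\<close>: the extra factor \<open>s\<close> on the left
    becomes an extra factor \<open>t\<close> on the right.\<close>
  also have "[s] @ ?a' @ [] = [] @ ?a @ [t]" unfolding a a' by simp
  also have "cls (mon \<dots>) = cls (mon ([] @ ?a' @ [t]))"
    by (rule braid) (use st in auto)
  also have "\<dots> = cls (nc_const (1 - q t) * mon ?a' + nc_const (q t) * mon ?b)"
    using cls_quadratic_context[of ?b "[]" t] st unfolding a' by simp
  also have "\<dots> = cls (nc_const (1 - q t) * mon ?a + nc_const (q t) * mon ?b)"
    using braid[of "[]" "[]"] lists
    by (intro cls_add_eq cls_mult_eq) (auto intro!: free_carrier_intros)
  finally have "nc_const (1 - q s) * mon ?a + nc_const (q s) * mon ?b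
      - (nc_const (1 - q t) * mon ?a + nc_const (q t) * mon ?b) \<in> I"
    using lists by (subst (asm) cls_eq_iff) (auto intro!: free_carrier_intros)
  also have "nc_const (1 - q s) * mon ?a + nc_const (q s) * mon ?b
      - (nc_const (1 - q t) * mon ?a + nc_const (q t) * mon ?b)
      = nc_const (q t - q s) * mon ?a + nc_const (q s - q t) * mon ?b"
    by (simp add: nc_const_diff algebra_simps)
  finally have 0: "cls (nc_const (q t - q s) * mon ?a + nc_const (q s - q t) * mon ?b) = cls 0"
    using lists by (subst cls_eq_iff) (auto intro!: free_carrier_intros)
  \<comment> \<open>By \<open>neq\<close> the index set has two elements, so the two coefficients
    are not merged into one term.\<close>
  define c where "c x = (if x = wp ?a then q t - q s else q s - q t)" for x
  let ?J = "{wp ?a, wp ?b}"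
  have J: "finite ?J" "?J \<subseteq> carrier W" using lists by auto
  have "comb ?J c = nc_const (q t - q s) * mon (rexp (wp ?a)) + nc_const (q s - q t) * mon (rexp (wp ?b))"
    using neq by (simp add: comb_def c_def)
  also have "cls \<dots> = cls (nc_const (q t - q s) * mon ?a + nc_const (q s - q t) * mon ?b)"
    using lists red rexp(3)[OF wp_closed]
    by (intro cls_add_eq cls_mult_eq cls_mon_rexp refl) (auto intro!: free_carrier_intros)
  finally have "(\<Oplus>\<^bsub>H\<^esub>x\<in>?J. c x \<odot>\<^bsub>H\<^esub> hecke_T W S m q x) = \<zero>\<^bsub>H\<^esub>"
    unfolding finsum_hecke_T[OF J] by (simp add: 0 hecke_simps)
  then have "c (wp ?a) = 0"
    using assms J unfolding independent_family_def by blast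
  then show "q s = q t" by (simp add: c_def)
qed

end

theorem theorem1p2:
  fixes W :: "'w monoid" and S :: "'w set" and m :: "'w \<Rightarrow> 'w \<Rightarrow> enat" and q :: "'w \<Rightarrow> 'f::field"
  assumes "coxeter_system W S m"
  shows "spanning_family (hecke_algebra S m q) (carrier W) (hecke_T W S m q) \<and>
    (basis_family (hecke_algebra S m q) (carrier W) (hecke_T W S m q) \<longleftrightarrow>
      (\<forall>s \<in> S. \<forall>t \<in> S. s \<noteq> t \<and> (\<exists>k. m s t = enat k \<and> odd k) \<longrightarrow> q s = q t))"
proof -
  interpret group W using assms by (simp add: coxeter_system_def)
  interpret hecke W S m q by unfold_locales (rule assms)
  show ?thesis
    using spanning independent independent_odd_constant
    unfolding basis_family_def odd_constant_def by blast
qed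

end
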